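(* Let $H$ be a finite graph without multiple edges, possibly with loops, and with no isolated vertices. Let $G$ be an $n$-vertex $2$-regular finite simple graph. Then \[ \hom(G,H) \leq \max \{\hom(C_{3},H)^{\frac{n}{3}}, \hom(C_{4},H)^{\frac{n}{4}}\}. \] Moreover, if $H$ is not of the form $K_{q}^{\text{loop}}$ (for any $q \ge 1$), then the only graphs $G$ achieving equality are: $G = \frac{n}{3} C_3$ when $\hom(C_3,H)^{\frac{1}{3}} > \hom(C_4,H)^{\frac{1}{4}}$; $G = \frac{n}{4} C_4$ when $\hom(C_3,H)^{\frac{1}{3}} < \hom(C_4,H)^{\frac{1}{4}}$; and disjoint unions of copies of $C_3$ and copies of $C_4$ when $\hom(C_3,H)^{\frac{1}{3}} = \hom(C_4,H)^{\frac{1}{4}}$.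
   Context: For a finite simple (loopless) graph $G$ and a finite graph $H$ (no multiple edges, loops allowed), $\hom(G,H)$ is the number of maps $f:V(G)\to V(H)$ such that $v\sim_G w$ implies $f(v)\sim_H f(w)$. A vertex of $H$ is isolated if it is incident to no edge and no loop (a looped vertex is not isolated). $C_k$ is the cycle on $k$ vertices. $K_q^{\text{loop}}$ is the fully looped complete graph on $q$ vertices (all pairs of vertices adjacent, including each vertex to itself). $\frac{n}{k}F$, for a $k$-vertex graph $F$, is the disjoint union of $n/k$ copies of $F$ (it exists only when $k \mid n$). Graph equality is up to isomorphism. *)

theory Defs
  imports Complex_Main "HOL-Library.FuncSet" "Graph_Theory.Graph_Theory"
begin

text \<open>
  An undirected graph without multiple edges is a symmetric pair digraph: the edge \<open>uv\<close> is the
  pair of arcs \<open>(u,v)\<close>, \<open>(v,u)\<close>, and a loop at \<open>v\<close> is the single arc \<open>(v,v)\<close>. So finite simple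
  graphs are instances of \<^locale>\<open>pair_graph\<close>, finite graphs with loops allowed are instances of
  \<^locale>\<open>pair_pseudo_graph\<close>, and \<^const>\<open>out_degree\<close> is the degree of a vertex of a simple graph.
\<close>

text \<open>
  Extensional functions, so that maps differing only outside the vertex set are not counted
  separately.
\<close>

definition graph_homs :: "'a pair_pre_digraph \<Rightarrow> 'b pair_pre_digraph \<Rightarrow> ('a \<Rightarrow> 'b) set" where
  "graph_homs G H =
    {f \<in> pverts G \<rightarrow>\<^sub>E pverts H. \<forall>u v. (u, v) \<in> parcs G \<longrightarrow> (f u, f v) \<in> parcs H}"

definition hom_count :: "'a pair_pre_digraph \<Rightarrow> 'b pair_pre_digraph \<Rightarrow> nat" where
  "hom_count G H = card (graph_homs G H)"

definition isolated_vertex :: "'a pair_pre_digraph \<Rightarrow> 'a \<Rightarrow> bool" where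
  "isolated_vertex H v \<longleftrightarrow> v \<in> pverts H \<and> (\<forall>e \<in> parcs H. fst e \<noteq> v \<and> snd e \<noteq> v)"

text \<open>Intended for \<open>k \<ge> 3\<close>; for \<open>k = 1\<close> this has a loop, for \<open>k = 2\<close> it is a single edge.\<close>

definition cycle_graph :: "nat \<Rightarrow> nat pair_pre_digraph" where
  "cycle_graph k = \<lparr> pverts = {..<k},
    parcs = {(i, j). i < k \<and> j < k \<and> (j = Suc i mod k \<or> i = Suc j mod k)} \<rparr>"

definition looped_complete_graph :: "nat \<Rightarrow> nat pair_pre_digraph" where
  "looped_complete_graph q = \<lparr> pverts = {..<q}, parcs = {..<q} \<times> {..<q} \<rparr>"

definition copies :: "nat \<Rightarrow> 'a pair_pre_digraph \<Rightarrow> (nat \<times> 'a) pair_pre_digraph" where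
  "copies m F = \<lparr> pverts = {..<m} \<times> pverts F,
    parcs = {((i, u), (i, v)) | i u v. i < m \<and> (u, v) \<in> parcs F} \<rparr>"

definition disjoint_union ::
    "'a pair_pre_digraph \<Rightarrow> 'b pair_pre_digraph \<Rightarrow> ('a + 'b) pair_pre_digraph" where
  "disjoint_union F G = \<lparr> pverts = pverts F <+> pverts G,
    parcs = map_prod Inl Inl ` parcs F \<union> map_prod Inr Inr ` parcs G \<rparr>"

definition graph_iso :: "'a pair_pre_digraph \<Rightarrow> 'b pair_pre_digraph \<Rightarrow> bool" (infix "\<simeq>\<^sub>g" 50) where
  "F \<simeq>\<^sub>g G \<longleftrightarrow> digraph_iso (with_proj F) (with_proj G)"

end

theory Submission
  imports Defs
begin

text \<open>
  A 2-regular graph is a disjoint union of cycles and \<open>hom\<close> is multiplicative over disjoint unions,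
  so everything reduces to \<open>hom(C\<^sub>k, H)\<close>, the number \<open>N k\<close> of closed \<open>k\<close>-walks in \<open>H\<close>, i.e. the
  trace of the \<open>k\<close>-th power of the adjacency matrix \<open>A\<close>. Instead of eigenvalues, only the
  Cauchy-Schwarz inequality is used: \<open>N (2a)\<close> is the squared Frobenius norm of the \<open>a\<close>-th power of
  \<open>A\<close>, whence \<open>(N (a + b))\<^sup>2 \<le> N (2a) * N (2b)\<close> and \<open>N (2 (a + b)) \<le> N (2a) * N (2b)\<close>. Together these
  give \<open>(N k)\<^sup>4 \<le> (N 4)\<^sup>k\<close> for \<open>k \<ge> 4\<close>. If equality holds for some \<open>k \<ge> 5\<close>, then \<open>N 8 = (N 4)\<^sup>2\<close>, which
  forces the rows of the squared adjacency matrix to be pairwise proportional; then all vertices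
  of \<open>H\<close> have the same neighbourhood, and without isolated vertices \<open>H\<close> is complete with all loops.
\<close>

section \<open>Closed walks\<close>

text \<open>Entries of the powers of the adjacency matrix, taken in the reals so that squares can be
  subtracted and compared. The zeroth power is the identity on the whole type, so only entries
  indexed by vertices are meaningful.\<close>

primrec walk_count :: "'b pair_pre_digraph \<Rightarrow> nat \<Rightarrow> 'b \<Rightarrow> 'b \<Rightarrow> real" where
  "walk_count H 0 i j = of_bool (i = j)"
| "walk_count H (Suc k) i j = (\<Sum>m\<in>pverts H. walk_count H k i m * of_bool ((m, j) \<in> parcs H))"

definition closed_walks :: "'b pair_pre_digraph \<Rightarrow> nat \<Rightarrow> real" where
  "closed_walks H k = (\<Sum>i\<in>pverts H. walk_count H k i i)"

section \<open>Cauchy-Schwarz for finite sums, with its equality case\<close>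

lemma Lagrange_identity_sum:
  fixes x y :: "'i \<Rightarrow> real"
  shows "(\<Sum>l\<in>S. (x l)\<^sup>2) * (\<Sum>l\<in>S. (y l)\<^sup>2) - (\<Sum>l\<in>S. x l * y l)\<^sup>2
    = (\<Sum>l\<in>S. \<Sum>m\<in>S. (x l * y m - x m * y l)\<^sup>2) / 2"
proof -
  \<comment> \<open>Each unordered pair of indices is met twice, which accounts for the division by
    2. For infinite \<open>S\<close> every sum is 0, so no finiteness is assumed.\<close>
  have "(\<Sum>l\<in>S. \<Sum>m\<in>S. (x l * y m - x m * y l)\<^sup>2)
      = (\<Sum>l\<in>S. \<Sum>m\<in>S. (x l)\<^sup>2 * (y m)\<^sup>2) + (\<Sum>l\<in>S. \<Sum>m\<in>S. (y l)\<^sup>2 * (x m)\<^sup>2)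
        - 2 * (\<Sum>l\<in>S. \<Sum>m\<in>S. (x l * y l) * (x m * y m))"
    by (simp add: sum.distrib sum_subtractf sum_distrib_left power2_diff power_mult_distrib
        algebra_simps)
  also have "\<dots> = 2 * ((\<Sum>l\<in>S. (x l)\<^sup>2) * (\<Sum>l\<in>S. (y l)\<^sup>2) - (\<Sum>l\<in>S. x l * y l)\<^sup>2)"
    by (simp add: sum_product[symmetric] power2_eq_square[of "sum _ _"])
  finally show ?thesis by simp
qed

lemma Cauchy_Schwarz_sum:
  fixes x y :: "'i \<Rightarrow> real"
  shows "(\<Sum>l\<in>S. x l * y l)\<^sup>2 \<le> (\<Sum>l\<in>S. (x l)\<^sup>2) * (\<Sum>l\<in>S. (y l)\<^sup>2)"
proof -
  have "0 \<le> (\<Sum>l\<in>S. \<Sum>m\<in>S. (x l * y m - x m * y l)\<^sup>2) / 2"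
    by (simp add: sum_nonneg)
  then show ?thesis unfolding Lagrange_identity_sum[symmetric] by simp
qed

text \<open>Equality makes the Lagrange sum of squares vanish, hence every 2 by 2 minor of the two
  vectors is zero: they are proportional.\<close>

lemma Cauchy_Schwarz_sum_eqD:
  fixes x y :: "'i \<Rightarrow> real"
  assumes "finite S" "(\<Sum>l\<in>S. x l * y l)\<^sup>2 = (\<Sum>l\<in>S. (x l)\<^sup>2) * (\<Sum>l\<in>S. (y l)\<^sup>2)"
    and "l \<in> S" "m \<in> S"
  shows "x l * y m = x m * y l"
proof -
  have "(\<Sum>l\<in>S. \<Sum>m\<in>S. (x l * y m - x m * y l)\<^sup>2) = 0"
    using Lagrange_identity_sum[of x S y] assms(2) by simp
  then have "(x l * y m - x m * y l)\<^sup>2 = 0"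
    using assms by (simp add: sum_nonneg_eq_0_iff sum_nonneg)
  then show ?thesis by simp
qed

section \<open>Powers of the adjacency matrix and their Frobenius norms\<close>

context pair_pseudo_graph begin

lemma walk_count_add:
  assumes "i \<in> pverts G" "j \<in> pverts G"
  shows "walk_count G (a + b) i j = (\<Sum>l\<in>pverts G. walk_count G a i l * walk_count G b l j)"
  using assms(2)
proof (induction b arbitrary: j)
  case 0
  then show ?case
    using pair_finite_verts by (simp add: sum_mult_of_bool_eq)
next
  case (Suc b)
  have "walk_count G (a + Suc b) i j
      = (\<Sum>m\<in>pverts G. (\<Sum>l\<in>pverts G. walk_count G a i l * walk_count G b l m)
          * of_bool ((m, j) \<in> parcs G))"
    using Suc.IH by (simp del: sum_mult_of_bool_eq)
  also have "\<dots> = (\<Sum>m\<in>pverts G. \<Sum>l\<in>pverts G. walk_count G a i l * walk_count G b l m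
          * of_bool ((m, j) \<in> parcs G))"
    by (simp add: sum_distrib_right)
  also have "\<dots> = (\<Sum>l\<in>pverts G. \<Sum>m\<in>pverts G. walk_count G a i l * walk_count G b l m
          * of_bool ((m, j) \<in> parcs G))"
    by (rule sum.swap)
  finally show ?case by (simp add: sum_distrib_left mult.assoc del: sum_mult_of_bool_eq)
qed

lemma walk_count_1:
  assumes "i \<in> pverts G"
  shows "walk_count G 1 i j = of_bool ((i, j) \<in> parcs G)"
  using assms pair_finite_verts by (simp add: sum_of_bool_mult_eq)

text \<open>Powers of a symmetric matrix are symmetric. The recursion appends an arc at the end, so
  the reversed walk has its first arc split off by \<open>walk_count_add\<close> with
  \<open>1 + k\<close>.\<close>

lemma walk_count_sym:
  assumes "i \<in> pverts G" "j \<in> pverts G"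
  shows "walk_count G k i j = walk_count G k j i"
  using assms
proof (induction k arbitrary: i j)
  case (Suc k)
  have "walk_count G (Suc k) j i = walk_count G (1 + k) j i" by simp
  also have "\<dots> = (\<Sum>m\<in>pverts G. walk_count G 1 j m * walk_count G k m i)"
    using Suc.prems by (intro walk_count_add)
  also have "\<dots> = (\<Sum>m\<in>pverts G. walk_count G k i m * of_bool ((m, j) \<in> parcs G))"
  proof (rule sum.cong[OF refl])
    fix m assume m: "m \<in> pverts G"
    have "(j, m) \<in> parcs G \<longleftrightarrow> (m, j) \<in> parcs G" using arcs_symmetric by blast
    then show "walk_count G 1 j m * walk_count G k m i
        = walk_count G k i m * of_bool ((m, j) \<in> parcs G)"
      using Suc m by (simp add: walk_count_1 del: One_nat_def)
  qed
  finally show ?case by simp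
qed (simp add: eq_commute)

text \<open>The trace of a product of two symmetric matrices is their Frobenius inner product, to
  which Cauchy-Schwarz can be applied.\<close>

lemma closed_walks_add:
  "closed_walks G (a + b) = (\<Sum>(i, j)\<in>pverts G \<times> pverts G. walk_count G a i j * walk_count G b i j)"
  unfolding closed_walks_def sum.cartesian_product[symmetric]
  by (intro sum.cong refl) (simp add: walk_count_add walk_count_sym cong: sum.cong)

lemma closed_walks_double:
  "closed_walks G (2 * a) = (\<Sum>(i, j)\<in>pverts G \<times> pverts G. (walk_count G a i j)\<^sup>2)"
  using closed_walks_add[of a a] by (simp add: mult_2 power2_eq_square)

lemma closed_walks_add_power2_le:
  "(closed_walks G (a + b))\<^sup>2 \<le> closed_walks G (2 * a) * closed_walks G (2 * b)"
  using Cauchy_Schwarz_sum[where S="pverts G \<times> pverts G" and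
      x="\<lambda>(i,j). walk_count G a i j" and y="\<lambda>(i,j). walk_count G b i j"]
  by (simp add: closed_walks_add closed_walks_double case_prod_unfold)

text \<open>By symmetry the entry is the inner product of row \<open>i\<close> of one power with row
  \<open>j\<close> of the other; the two factors are the squared norms of these rows.\<close>

lemma walk_count_add_power2_le:
  assumes "i \<in> pverts G" "j \<in> pverts G"
  shows "(walk_count G (a + b) i j)\<^sup>2
    \<le> (\<Sum>l\<in>pverts G. (walk_count G a i l)\<^sup>2) * (\<Sum>l\<in>pverts G. (walk_count G b j l)\<^sup>2)"
proof -
  have "walk_count G (a + b) i j = (\<Sum>l\<in>pverts G. walk_count G a i l * walk_count G b j l)"
    using assms by (simp add: walk_count_add walk_count_sym cong: sum.cong)
  then show ?thesis using Cauchy_Schwarz_sum by metis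
qed

lemma closed_walks_double_mult:
  "closed_walks G (2 * a) * closed_walks G (2 * b) = (\<Sum>(i, j)\<in>pverts G \<times> pverts G.
     (\<Sum>l\<in>pverts G. (walk_count G a i l)\<^sup>2) * (\<Sum>l\<in>pverts G. (walk_count G b j l)\<^sup>2))"
  by (simp add: closed_walks_double sum.cartesian_product[symmetric] sum_product)

text \<open>Submultiplicativity of the Frobenius norm: the bound for single entries is summed over
  all pairs of vertices.\<close>

lemma closed_walks_double_add_le:
  "closed_walks G (2 * (a + b)) \<le> closed_walks G (2 * a) * closed_walks G (2 * b)"
  unfolding closed_walks_double_mult unfolding closed_walks_double
  by (intro sum_mono) (auto intro: walk_count_add_power2_le)

lemma closed_walks_double_nonneg: "0 \<le> closed_walks G (2 * a)"
  unfolding closed_walks_double by (intro sum_nonneg) auto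

section \<open>Common neighbours, and strictness when some pair of vertices is not joined\<close>

lemma walk_count_2:
  assumes "i \<in> pverts G" "j \<in> pverts G"
  shows "walk_count G 2 i j = card (parcs G `` {i} \<inter> parcs G `` {j})"
proof -
  have "walk_count G 2 i j
      = (\<Sum>m\<in>pverts G. walk_count G 1 i m * of_bool ((m, j) \<in> parcs G))"
    by (simp add: numeral_2_eq_2 del: One_nat_def) simp
  also have "\<dots> = (\<Sum>m\<in>pverts G. of_bool (m \<in> parcs G `` {i} \<inter> parcs G `` {j}))"
    using assms arcs_symmetric
    by (intro sum.cong refl) (auto simp: walk_count_1 simp del: One_nat_def walk_count.simps)
  also have "\<dots> = card (pverts G \<inter> (parcs G `` {i} \<inter> parcs G `` {j}))"
    using pair_finite_verts by (simp add: sum_of_bool_eq Int_def)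
  also have "pverts G \<inter> (parcs G `` {i} \<inter> parcs G `` {j}) = parcs G `` {i} \<inter> parcs G `` {j}"
    using in_arcsD2 by blast
  finally show ?thesis .
qed

text \<open>Among the squares summing to \<open>closed_walks G 4\<close>, the one at
  \<open>(u, u)\<close> is the squared number of neighbours of \<open>u\<close>, and
  \<open>v\<close> is such a neighbour.\<close>

lemma closed_walks_4_pos:
  assumes "(u, v) \<in> parcs G"
  shows "0 < closed_walks G 4"
proof -
  have u: "u \<in> pverts G" using assms in_arcsD1 by blast
  have "finite (parcs G `` {u})" using pair_finite_arcs by (simp add: finite_Image)
  moreover have "v \<in> parcs G `` {u}" using assms by simp
  ultimately have "0 < card (parcs G `` {u})" by (auto simp: card_gt_0_iff)
  then have "walk_count G 2 u u \<noteq> 0"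
    unfolding walk_count_2[OF u u] Int_absorb of_nat_eq_0_iff by (rule less_imp_neq[THEN not_sym])
  then have "0 < (walk_count G 2 u u)\<^sup>2" by simp
  also have "\<dots> \<le> closed_walks G (2 * 2)"
    unfolding closed_walks_double using u pair_finite_verts
    by (intro member_le_sum[where i="(u, u)" and f="\<lambda>(i, j). (walk_count G 2 i j)\<^sup>2", simplified])
      auto
  finally show ?thesis by simp
qed

text \<open>Equality would make the Cauchy-Schwarz bound tight for every entry of the fourth power,
  so any two rows of the squared matrix would be proportional. Their entries count common
  neighbours, and this forces all neighbourhoods to coincide.\<close>

lemma closed_walks_8_less:
  assumes no_isolated: "\<And>v. v \<in> pverts G \<Longrightarrow> parcs G `` {v} \<noteq> {}"
    and ij: "i \<in> pverts G" "j \<in> pverts G" "(i, j) \<notin> parcs G"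
  shows "closed_walks G 8 < (closed_walks G 4)\<^sup>2"
proof (rule ccontr)
  assume "\<not> ?thesis"
  then have eq: "(closed_walks G 4)\<^sup>2 = closed_walks G 8"
    using closed_walks_double_add_le[of 2 2] by (simp add: power2_eq_square)
  let ?N = "\<lambda>v. parcs G `` {v}"
  have fin: "finite (?N v)" for v using pair_finite_arcs by (simp add: finite_Image)
  have N_eq: "?N p = ?N q" if p: "p \<in> pverts G" and q: "q \<in> pverts G" for p q
  proof -
    let ?f = "\<lambda>(i, j). (\<Sum>l\<in>pverts G. (walk_count G 2 i l)\<^sup>2) * (\<Sum>l\<in>pverts G. (walk_count G 2 j l)\<^sup>2)
       - (walk_count G 4 i j)\<^sup>2"
    \<comment> \<open>The defects \<open>?f\<close> are nonnegative and add up to the difference of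
      the two sides of \<open>eq\<close>, so each of them is zero.\<close>
    have "sum ?f (pverts G \<times> pverts G) = 0"
      using eq closed_walks_double_mult[of 2 2] closed_walks_double[of 4]
      by (simp add: case_prod_unfold sum_subtractf power2_eq_square)
    moreover have "\<And>x. x \<in> pverts G \<times> pverts G \<Longrightarrow> 0 \<le> ?f x"
      using walk_count_add_power2_le[of _ _ 2 2] by auto
    ultimately have "?f (p, q) = 0"
      using p q pair_finite_verts sum_nonneg_eq_0_iff[of "pverts G \<times> pverts G" ?f] by blast
    moreover have "walk_count G (2 + 2) p q = (\<Sum>l\<in>pverts G. walk_count G 2 p l * walk_count G 2 q l)"
      using p q by (subst walk_count_add) (auto simp: walk_count_sym intro!: sum.cong)
    \<comment> \<open>Of all vanishing minors of rows \<open>p\<close> and \<open>q\<close>, the one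
      in columns \<open>p\<close> and \<open>q\<close> suffices: it relates the two degrees to the
      number of common neighbours.\<close>
    ultimately have "walk_count G 2 p p * walk_count G 2 q q = walk_count G 2 p q * walk_count G 2 q p"
      using Cauchy_Schwarz_sum_eqD[of "pverts G" "walk_count G 2 p" "walk_count G 2 q" p q]
        p q pair_finite_verts by simp
    then have "real (card (?N p) * card (?N q)) = real (card (?N p \<inter> ?N q) * card (?N p \<inter> ?N q))"
      using p q by (simp add: walk_count_2 Int_commute)
    then have card: "card (?N p) * card (?N q) = card (?N p \<inter> ?N q) * card (?N p \<inter> ?N q)"
      by (simp only: of_nat_eq_iff)
    have pos: "0 < card (?N p)" "0 < card (?N q)"
      using no_isolated p q fin by (auto simp: card_gt_0_iff)
    have le: "card (?N p \<inter> ?N q) \<le> card (?N p)" "card (?N p \<inter> ?N q) \<le> card (?N q)"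
      by (auto intro: card_mono fin)
    \<comment> \<open>The number of common neighbours is at most either degree, while its square is
      the product of the degrees; so it equals both.\<close>
    have "card (?N p \<inter> ?N q) = card (?N p)"
    proof (rule ccontr)
      assume "card (?N p \<inter> ?N q) \<noteq> card (?N p)"
      then have less: "card (?N p \<inter> ?N q) < card (?N p)" using le by simp
      have "card (?N p \<inter> ?N q) * card (?N p \<inter> ?N q) \<le> card (?N p \<inter> ?N q) * card (?N q)"
        using le by (intro mult_left_mono) auto
      also have "\<dots> < card (?N p) * card (?N q)"
        using less pos by (intro mult_strict_right_mono) auto
      finally show False using card by simp
    qed
    moreover have "card (?N p \<inter> ?N q) = card (?N q)"
      using card pos(1) calculation nat_mult_eq_cancel1 by metis
    ultimately have "?N p \<inter> ?N q = ?N p" "?N p \<inter> ?N q = ?N q"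
      by (simp_all add: card_subset_eq fin)
    then show ?thesis by simp
  qed
  \<comment> \<open>A neighbour \<open>u\<close> of \<open>j\<close> has \<open>j\<close> in its
    neighbourhood, which is also the neighbourhood of \<open>i\<close>; this contradicts the missing
    arc.\<close>
  obtain u where "(j, u) \<in> parcs G" using no_isolated ij by blast
  then have "(u, j) \<in> parcs G" "u \<in> pverts G" using arcs_symmetric in_arcsD2 by auto
  then have "(i, j) \<in> parcs G" using N_eq[of u i] ij by blast
  then show False using ij by simp
qed

section \<open>Bounding all closed walk counts by the count for length 4\<close>

lemma closed_walks_mult_4_le: "closed_walks G (4 * Suc p) \<le> closed_walks G 4 ^ Suc p"
proof (induction p)
  case (Suc p)
  \<comment> \<open>One factor \<open>closed_walks G 4\<close> is peeled off at a time. The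
    induction cannot start at length 0, where the count is the number of vertices and may exceed
    1.\<close>
  have "closed_walks G (4 * Suc (Suc p)) = closed_walks G (2 * (2 + 2 * Suc p))"
    by (rule arg_cong[where f="closed_walks G"]) simp
  also have "\<dots> \<le> closed_walks G (2 * 2) * closed_walks G (2 * (2 * Suc p))"
    by (rule closed_walks_double_add_le)
  also have "\<dots> = closed_walks G 4 * closed_walks G (4 * Suc p)"
    by (simp only: mult.assoc[symmetric]) simp
  also have "\<dots> \<le> closed_walks G 4 * closed_walks G 4 ^ Suc p"
    using Suc.IH closed_walks_double_nonneg[of 2] by (intro mult_left_mono) auto
  finally show ?case by simp
qed simp

text \<open>The first strict instance is length 8, given by the hypothesis; peeling off positive
  factors preserves strictness.\<close>

lemma closed_walks_mult_4_less:
  assumes "0 < closed_walks G 4" "closed_walks G 8 < (closed_walks G 4)\<^sup>2"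
  shows "closed_walks G (4 * Suc (Suc p)) < closed_walks G 4 ^ Suc (Suc p)"
proof (induction p)
  case 0
  then show ?case using assms(2) by (simp add: power2_eq_square)
next
  case (Suc p)
  have "closed_walks G (4 * Suc (Suc (Suc p))) = closed_walks G (2 * (2 + 2 * Suc (Suc p)))"
    by (rule arg_cong[where f="closed_walks G"]) simp
  also have "\<dots> \<le> closed_walks G (2 * 2) * closed_walks G (2 * (2 * Suc (Suc p)))"
    by (rule closed_walks_double_add_le)
  also have "\<dots> = closed_walks G 4 * closed_walks G (4 * Suc (Suc p))"
    by (simp only: mult.assoc[symmetric]) simp
  also have "\<dots> < closed_walks G 4 * closed_walks G 4 ^ Suc (Suc p)"
    using Suc.IH assms(1) by (intro mult_strict_left_mono) auto
  finally show ?case by simp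
qed

text \<open>Cauchy-Schwarz for the splitting \<open>2 * m = 2 + 2 * (m - 1)\<close> leaves the
  lengths 4 and \<open>4 * (m - 1)\<close>, and the latter is a positive multiple of 4.\<close>

lemma closed_walks_even_le:
  assumes "2 \<le> m"
  shows "(closed_walks G (2 * m))\<^sup>2 \<le> closed_walks G 4 ^ m"
proof -
  obtain p where m: "m = Suc (Suc p)" using assms by (metis add_2_eq_Suc le_Suc_ex)
  have "(closed_walks G (2 * m))\<^sup>2 = (closed_walks G (2 + 2 * Suc p))\<^sup>2" by (simp add: m)
  also have "\<dots> \<le> closed_walks G (2 * 2) * closed_walks G (2 * (2 * Suc p))"
    by (rule closed_walks_add_power2_le)
  also have "\<dots> = closed_walks G 4 * closed_walks G (4 * Suc p)"
    by (simp only: mult.assoc[symmetric]) simp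
  also have "\<dots> \<le> closed_walks G 4 * closed_walks G 4 ^ Suc p"
    using closed_walks_mult_4_le[of p] closed_walks_double_nonneg[of 2]
    by (intro mult_left_mono) auto
  finally show ?thesis by (simp add: m)
qed

text \<open>With \<open>m\<close> at least 3 the length \<open>4 * (m - 1)\<close> is at least 8,
  where the bound for multiples of 4 is strict.\<close>

lemma closed_walks_even_less:
  assumes "0 < closed_walks G 4" "closed_walks G 8 < (closed_walks G 4)\<^sup>2" "3 \<le> m"
  shows "(closed_walks G (2 * m))\<^sup>2 < closed_walks G 4 ^ m"
proof -
  obtain p where m: "m = Suc (Suc (Suc p))"
    using assms(3) by (metis add_Suc add_2_eq_Suc le_Suc_ex numeral_3_eq_3 plus_nat.add_0)
  have "(closed_walks G (2 * m))\<^sup>2 = (closed_walks G (2 + 2 * Suc (Suc p)))\<^sup>2" by (simp add: m)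
  also have "\<dots> \<le> closed_walks G (2 * 2) * closed_walks G (2 * (2 * Suc (Suc p)))"
    by (rule closed_walks_add_power2_le)
  also have "\<dots> = closed_walks G 4 * closed_walks G (4 * Suc (Suc p))"
    by (simp only: mult.assoc[symmetric]) simp
  also have "\<dots> < closed_walks G 4 * closed_walks G 4 ^ Suc (Suc p)"
    using closed_walks_mult_4_less[of p] assms by (intro mult_strict_left_mono) auto
  finally show ?thesis by (simp add: m)
qed

text \<open>Cauchy-Schwarz for the most balanced splitting, \<open>m + (m + 1)\<close>, leaves two
  even lengths. Squaring once more matches the form of the even bounds.\<close>

lemma closed_walks_odd_le:
  assumes "2 \<le> m"
  shows "closed_walks G (2 * m + 1) ^ 4 \<le> (closed_walks G (2 * m))\<^sup>2 * (closed_walks G (2 * (m + 1)))\<^sup>2"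
proof -
  have "((closed_walks G (m + (m + 1)))\<^sup>2)\<^sup>2
      \<le> (closed_walks G (2 * m) * closed_walks G (2 * (m + 1)))\<^sup>2"
    by (intro power_mono closed_walks_add_power2_le) auto
  then show ?thesis by (simp add: power_mult_distrib mult_2 flip: power_mult)
qed

text \<open>Fourth powers keep all exponents integral. For odd \<open>k = 2 * m + 1\<close> the even
  bounds for \<open>m\<close> and \<open>m + 1\<close> are multiplied, and their exponents add up to
  \<open>k\<close>.\<close>

lemma closed_walks_power4_le:
  assumes "4 \<le> k"
  shows "closed_walks G k ^ 4 \<le> closed_walks G 4 ^ k"
proof (cases "even k")
  case True
  then obtain m where k: "k = 2 * m" by blast
  have "((closed_walks G (2 * m))\<^sup>2)\<^sup>2 \<le> (closed_walks G 4 ^ m)\<^sup>2"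
    using assms k by (intro power_mono closed_walks_even_le) auto
  then show ?thesis by (simp add: k mult.commute flip: power_mult)
next
  case False
  then obtain m where k: "k = 2 * m + 1" by (auto elim: oddE)
  with assms have m: "2 \<le> m" by simp
  have "closed_walks G (2 * m + 1) ^ 4 \<le> (closed_walks G (2 * m))\<^sup>2 * (closed_walks G (2 * (m + 1)))\<^sup>2"
    using m by (rule closed_walks_odd_le)
  also have "\<dots> \<le> closed_walks G 4 ^ m * closed_walks G 4 ^ (m + 1)"
    using m closed_walks_double_nonneg[of 2]
    by (intro mult_mono closed_walks_even_le) auto
  finally show ?thesis unfolding k by (simp only: mult_2 add.assoc power_add)
qed

lemma closed_walks_power4_less:
  assumes "0 < closed_walks G 4" "closed_walks G 8 < (closed_walks G 4)\<^sup>2" "5 \<le> k"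
  shows "closed_walks G k ^ 4 < closed_walks G 4 ^ k"
proof (cases "even k")
  case True
  then obtain m where k: "k = 2 * m" by blast
  have "((closed_walks G (2 * m))\<^sup>2)\<^sup>2 < (closed_walks G 4 ^ m)\<^sup>2"
    using assms k by (intro power_strict_mono closed_walks_even_less) auto
  then show ?thesis by (simp add: k mult.commute flip: power_mult)
next
  case False
  then obtain m where k: "k = 2 * m + 1" by (auto elim: oddE)
  with assms have m: "2 \<le> m" by simp
  have "closed_walks G (2 * m + 1) ^ 4 \<le> (closed_walks G (2 * m))\<^sup>2 * (closed_walks G (2 * (m + 1)))\<^sup>2"
    using m by (rule closed_walks_odd_le)
  also have "\<dots> \<le> closed_walks G 4 ^ m * (closed_walks G (2 * (m + 1)))\<^sup>2"
    using m by (intro mult_right_mono closed_walks_even_le) auto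
  \<comment> \<open>Strictness has to come from the factor for \<open>m + 1\<close>: when
    \<open>k = 5\<close> the factor for \<open>m = 2\<close> is attained with equality.\<close>
  also have "\<dots> < closed_walks G 4 ^ m * closed_walks G 4 ^ (m + 1)"
    using m assms by (intro mult_strict_left_mono closed_walks_even_less) auto
  finally show ?thesis unfolding k by (simp only: mult_2 add.assoc power_add)
qed

end

section \<open>Isomorphisms and disjoint unions\<close>

text \<open>Reduces \<open>digraph_iso\<close>, whose witness is a record with separate maps for
  vertices, arcs and ends, to a vertex bijection that preserves and reflects adjacency.\<close>

lemma graph_isoI:
  assumes F: "pair_wf_digraph F" and G: "pair_wf_digraph G"
    and f: "bij_betw f (pverts F) (pverts G)"
    and arcs: "\<And>u v. u \<in> pverts F \<Longrightarrow> v \<in> pverts F \<Longrightarrow> (u, v) \<in> parcs F \<longleftrightarrow> (f u, f v) \<in> parcs G"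
  shows "F \<simeq>\<^sub>g G"
proof -
  interpret F: pair_wf_digraph F by (rule F)
  interpret G: pair_wf_digraph G by (rule G)
  have sub: "parcs F \<subseteq> pverts F \<times> pverts F" using F.in_arcsD1 F.in_arcsD2 by auto
  have "inj_on (map_prod f f) (pverts F \<times> pverts F)"
    using f by (intro map_prod_inj_on) (auto simp: bij_betw_def)
  then have inj: "inj_on (map_prod f f) (parcs F)" using sub by (rule inj_on_subset)
  have img: "map_prod f f ` parcs F = parcs G"
  proof
    show "map_prod f f ` parcs F \<subseteq> parcs G" using arcs sub by auto
    show "parcs G \<subseteq> map_prod f f ` parcs F"
    proof
      fix e assume e: "e \<in> parcs G"
      obtain u v where uv: "u \<in> pverts F" "v \<in> pverts F" "e = (f u, f v)"
        using G.in_arcsD1 G.in_arcsD2 e f unfolding bij_betw_def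
        by (metis (no_types, lifting) imageE prod.exhaust)
      then show "e \<in> map_prod f f ` parcs F" using arcs e by force
    qed
  qed
  let ?h = "\<lparr>iso_verts = f, iso_arcs = map_prod f f, iso_head = snd, iso_tail = fst\<rparr>"
  have "F.digraph_isomorphism ?h"
    unfolding F.digraph_isomorphism_def using f inj F.wf_digraph by (auto simp: bij_betw_def)
  moreover have "with_proj G = app_iso ?h (with_proj F)"
    using f img by (simp add: app_iso_def with_proj_def bij_betw_def)
  ultimately show ?thesis unfolding graph_iso_def digraph_iso_def by blast
qed

text \<open>On pair digraphs the ends of an arc are its components, so the arc map of the witness is
  forced to act componentwise through the vertex map.\<close>

lemma graph_isoE:
  assumes "F \<simeq>\<^sub>g G"
  obtains f where "pair_wf_digraph F" "pair_wf_digraph G" "bij_betw f (pverts F) (pverts G)"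
    "map_prod f f ` parcs F = parcs G"
proof -
  obtain h where h: "pre_digraph.digraph_isomorphism (with_proj F) h"
    and G: "with_proj G = app_iso h (with_proj F)"
    using assms unfolding graph_iso_def digraph_iso_def by blast
  have wf: "wf_digraph (with_proj F)" and inj: "inj_on (iso_verts h) (pverts F)"
    using h by (auto simp: pre_digraph.digraph_isomorphism_def)
  have "wf_digraph (with_proj G)" unfolding G using wf h by (rule wf_digraph.wf_digraphI_app_iso)
  moreover have verts: "pverts G = iso_verts h ` pverts F" and arcs: "parcs G = iso_arcs h ` parcs F"
    and tl: "iso_tail h = fst" and hd: "iso_head h = snd"
    using G by (simp_all add: with_proj_def app_iso_def)
  have "iso_arcs h a = map_prod (iso_verts h) (iso_verts h) a" if "a \<in> parcs F" for a
    using h that by (auto simp: pre_digraph.digraph_isomorphism_def tl hd prod_eq_iff)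
  then have "map_prod (iso_verts h) (iso_verts h) ` parcs F = parcs G" unfolding arcs by force
  ultimately show ?thesis
    using wf inj verts that[of "iso_verts h"] by (auto simp: wf_digraph_wp_iff bij_betw_def)
qed

lemma graph_iso_sym:
  assumes "F \<simeq>\<^sub>g G"
  shows "G \<simeq>\<^sub>g F"
proof -
  have "wf_digraph (with_proj F)"
    using assms by (auto elim: graph_isoE simp: wf_digraph_wp_iff)
  then show ?thesis using assms unfolding graph_iso_def by (rule digraph_iso_swap)
qed

lemma graph_iso_trans [trans]: "F \<simeq>\<^sub>g G \<Longrightarrow> G \<simeq>\<^sub>g K \<Longrightarrow> F \<simeq>\<^sub>g K"
  unfolding graph_iso_def by (rule digraph_iso_trans)

lemma hom_count_graph_iso:
  assumes "F \<simeq>\<^sub>g G"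
  shows "hom_count F H = hom_count G H"
proof -
  obtain f where wf: "pair_wf_digraph F" "pair_wf_digraph G"
    and f: "bij_betw f (pverts F) (pverts G)" and arcs: "map_prod f f ` parcs F = parcs G"
    using assms by (rule graph_isoE)
  interpret F: pair_wf_digraph F by (rule wf)
  interpret G: pair_wf_digraph G by (rule wf)
  define g where "g = inv_into (pverts F) f"
  have g: "bij_betw g (pverts G) (pverts F)" unfolding g_def using f by (rule bij_betw_inv_into)
  have gf: "g (f u) = u" if "u \<in> pverts F" for u
    using f that unfolding g_def by (simp add: bij_betw_inv_into_left)
  have fg: "f (g v) = v" if "v \<in> pverts G" for v
    using f that unfolding g_def by (simp add: bij_betw_inv_into_right)
  have fV: "f u \<in> pverts G" if "u \<in> pverts F" for u using f that by (auto simp: bij_betw_def)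
  have gV: "g v \<in> pverts F" if "v \<in> pverts G" for v using g that by (auto simp: bij_betw_def)
  have fE: "(f u, f v) \<in> parcs G" if "(u, v) \<in> parcs F" for u v using arcs that by force
  have gE: "(g u, g v) \<in> parcs F" if "(u, v) \<in> parcs G" for u v
  proof -
    have "(u, v) \<in> map_prod f f ` parcs F" using arcs that by simp
    then obtain a b where "(a, b) \<in> parcs F" "u = f a" "v = f b" by auto
    then show ?thesis using gf F.in_arcsD1 F.in_arcsD2 by metis
  qed
  \<comment> \<open>Precomposition with \<open>f\<close>, inverted by precomposition with
    \<open>g\<close>; the restrictions keep the maps extensional.\<close>
  have "bij_betw (\<lambda>h. \<lambda>u\<in>pverts F. h (f u)) (graph_homs G H) (graph_homs F H)"
  proof (rule bij_betw_byWitness[where f'="\<lambda>h. \<lambda>v\<in>pverts G. h (g v)"])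
    show "\<forall>h\<in>graph_homs G H. (\<lambda>v\<in>pverts G. (\<lambda>u\<in>pverts F. h (f u)) (g v)) = h"
      using fg gV by (auto simp: graph_homs_def fun_eq_iff PiE_iff extensional_def)
    show "\<forall>h\<in>graph_homs F H. (\<lambda>u\<in>pverts F. (\<lambda>v\<in>pverts G. h (g v)) (f u)) = h"
      using gf fV by (auto simp: graph_homs_def fun_eq_iff PiE_iff extensional_def)
    show "(\<lambda>h. \<lambda>u\<in>pverts F. h (f u)) ` graph_homs G H \<subseteq> graph_homs F H"
      using fV fE by (auto simp: graph_homs_def PiE_iff dest: F.in_arcsD1 F.in_arcsD2)
    show "(\<lambda>h. \<lambda>v\<in>pverts G. h (g v)) ` graph_homs F H \<subseteq> graph_homs G H"
      using gV gE by (auto simp: graph_homs_def PiE_iff dest: G.in_arcsD1 G.in_arcsD2)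
  qed
  then show ?thesis unfolding hom_count_def by (rule bij_betw_same_card[symmetric])
qed

lemma card_pverts_graph_iso:
  assumes "F \<simeq>\<^sub>g G"
  shows "card (pverts F) = card (pverts G)"
  using assms by (auto elim: graph_isoE intro: bij_betw_same_card)

text \<open>Generalises \<open>copies\<close> to components varying with the index. The free index
  type allows both vertices of a graph and a sum of two initial segments as indices.\<close>

definition indexed_union :: "'i set \<Rightarrow> ('i \<Rightarrow> 'a pair_pre_digraph) \<Rightarrow> ('i \<times> 'a) pair_pre_digraph" where
  "indexed_union I F = \<lparr> pverts = (SIGMA i:I. pverts (F i)),
    parcs = {((i, u), (i, v)) | i u v. i \<in> I \<and> (u, v) \<in> parcs (F i)} \<rparr>"

lemma indexed_union_simps:
  "pverts (indexed_union I F) = (SIGMA i:I. pverts (F i))"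
  "((i, u), (j, v)) \<in> parcs (indexed_union I F) \<longleftrightarrow> i = j \<and> i \<in> I \<and> (u, v) \<in> parcs (F i)"
  by (auto simp: indexed_union_def)

lemma pair_wf_digraph_indexed_union:
  assumes "\<And>i. i \<in> I \<Longrightarrow> pair_wf_digraph (F i)"
  shows "pair_wf_digraph (indexed_union I F)"
proof
  fix e assume "e \<in> parcs (indexed_union I F)"
  then obtain i u v where "i \<in> I" "(u, v) \<in> parcs (F i)" "e = ((i, u), (i, v))"
    by (auto simp: indexed_union_def)
  then show "fst e \<in> pverts (indexed_union I F)" "snd e \<in> pverts (indexed_union I F)"
    using pair_wf_digraph.in_arcsD1[OF assms] pair_wf_digraph.in_arcsD2[OF assms]
    by (auto simp: indexed_union_simps)
qed

text \<open>Currying turns a homomorphism on the union into an independent choice of one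
  homomorphism per component, so the set of homomorphisms is a dependent product.\<close>

lemma hom_count_indexed_union:
  assumes "finite I" and wf: "\<And>i. i \<in> I \<Longrightarrow> pair_wf_digraph (F i)"
  shows "hom_count (indexed_union I F) H = (\<Prod>i\<in>I. hom_count (F i) H)"
proof -
  let ?V = "SIGMA i:I. pverts (F i)"
  have sub: "u \<in> pverts (F i)" "v \<in> pverts (F i)" if "i \<in> I" "(u, v) \<in> parcs (F i)" for i u v
    using wf that pair_wf_digraph.in_arcsD1 pair_wf_digraph.in_arcsD2 by metis+
  have "bij_betw (\<lambda>f. \<lambda>i\<in>I. \<lambda>u\<in>pverts (F i). f (i, u))
    (graph_homs (indexed_union I F) H) (Pi\<^sub>E I (\<lambda>i. graph_homs (F i) H))"
  proof (rule bij_betw_byWitness[where f'="\<lambda>g. \<lambda>p\<in>?V. g (fst p) (snd p)"])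
    show "\<forall>f\<in>graph_homs (indexed_union I F) H.
        (\<lambda>p\<in>?V. (\<lambda>i\<in>I. \<lambda>u\<in>pverts (F i). f (i, u)) (fst p) (snd p)) = f"
      by (auto simp: graph_homs_def indexed_union_simps fun_eq_iff PiE_iff extensional_def)
    show "\<forall>g\<in>Pi\<^sub>E I (\<lambda>i. graph_homs (F i) H).
        (\<lambda>i\<in>I. \<lambda>u\<in>pverts (F i). (\<lambda>p\<in>?V. g (fst p) (snd p)) (i, u)) = g"
      by (auto simp: graph_homs_def fun_eq_iff PiE_iff extensional_def)
    show "(\<lambda>f. \<lambda>i\<in>I. \<lambda>u\<in>pverts (F i). f (i, u)) ` graph_homs (indexed_union I F) H
        \<subseteq> Pi\<^sub>E I (\<lambda>i. graph_homs (F i) H)"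
      using sub by (auto simp: graph_homs_def indexed_union_simps PiE_iff)
    show "(\<lambda>g. \<lambda>p\<in>?V. g (fst p) (snd p)) ` Pi\<^sub>E I (\<lambda>i. graph_homs (F i) H)
        \<subseteq> graph_homs (indexed_union I F) H"
      using sub by (auto simp: graph_homs_def indexed_union_simps PiE_iff)
  qed
  then have "hom_count (indexed_union I F) H = card (Pi\<^sub>E I (\<lambda>i. graph_homs (F i) H))"
    unfolding hom_count_def by (rule bij_betw_same_card)
  then show ?thesis using assms(1) by (simp add: card_PiE hom_count_def)
qed

lemma card_pverts_indexed_union:
  assumes "finite I" "\<And>i. i \<in> I \<Longrightarrow> finite (pverts (F i))"
  shows "card (pverts (indexed_union I F)) = (\<Sum>i\<in>I. card (pverts (F i)))"
  using assms by (simp add: indexed_union_simps card_SigmaI)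

lemma indexed_union_reindex:
  assumes p: "bij_betw p I J" and eq: "\<And>i. i \<in> I \<Longrightarrow> F i = F' (p i)"
    and wf: "\<And>i. i \<in> I \<Longrightarrow> pair_wf_digraph (F i)"
  shows "indexed_union I F \<simeq>\<^sub>g indexed_union J F'"
proof (rule graph_isoI[where f="map_prod p id"])
  have J: "J = p ` I" and inj: "inj_on p I" using p by (auto simp: bij_betw_def)
  show "pair_wf_digraph (indexed_union I F)" using wf by (rule pair_wf_digraph_indexed_union)
  show "pair_wf_digraph (indexed_union J F')"
    using wf eq by (intro pair_wf_digraph_indexed_union) (auto simp: J)
  show "bij_betw (map_prod p id) (pverts (indexed_union I F)) (pverts (indexed_union J F'))"
    using inj eq by (auto simp: bij_betw_def indexed_union_simps J inj_on_def image_iff)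
  show "(u, v) \<in> parcs (indexed_union I F)
      \<longleftrightarrow> (map_prod p id u, map_prod p id v) \<in> parcs (indexed_union J F')"
    if "u \<in> pverts (indexed_union I F)" "v \<in> pverts (indexed_union I F)" for u v
    using that inj eq by (auto simp: indexed_union_simps J inj_on_def)
qed

lemma copies_eq_indexed_union: "copies m F = indexed_union {..<m} (\<lambda>_. F)"
  by (auto simp: copies_def indexed_union_def)

text \<open>The isomorphism only moves the tag outwards, from \<open>(Inl i, u)\<close> to
  \<open>Inl (i, u)\<close>, and likewise for \<open>Inr\<close>.\<close>

lemma indexed_union_iso_disjoint_union_copies:
  assumes "pair_wf_digraph F" "pair_wf_digraph F'"
  shows "indexed_union ({..<a} <+> {..<b}) (case_sum (\<lambda>_. F) (\<lambda>_. F'))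
    \<simeq>\<^sub>g disjoint_union (copies a F) (copies b F')" (is "?L \<simeq>\<^sub>g ?R")
proof (rule graph_isoI[where f="\<lambda>(s, u). map_sum (\<lambda>i. (i, u)) (\<lambda>i. (i, u)) s"])
  show "pair_wf_digraph ?L"
    using assms by (intro pair_wf_digraph_indexed_union) (auto split: sum.split)
  show "pair_wf_digraph ?R"
    using assms by unfold_locales (auto simp: disjoint_union_def copies_def
        dest: pair_wf_digraph.in_arcsD1 pair_wf_digraph.in_arcsD2)
  show "bij_betw (\<lambda>(s, u). map_sum (\<lambda>i. (i, u)) (\<lambda>i. (i, u)) s) (pverts ?L) (pverts ?R)"
    by (rule bij_betw_byWitness[where f'="case_sum (map_prod Inl id) (map_prod Inr id)"])
      (auto simp: disjoint_union_def copies_def indexed_union_simps)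
  show "(x, y) \<in> parcs ?L \<longleftrightarrow> ((\<lambda>(s, u). map_sum (\<lambda>i. (i, u)) (\<lambda>i. (i, u)) s) x,
       (\<lambda>(s, u). map_sum (\<lambda>i. (i, u)) (\<lambda>i. (i, u)) s) y) \<in> parcs ?R"
    if "x \<in> pverts ?L" "y \<in> pverts ?L" for x y
    using that by (auto simp: disjoint_union_def copies_def indexed_union_simps image_iff)
qed

section \<open>Cycle decomposition of 2-regular graphs\<close>

lemma pair_wf_digraph_cycle_graph: "pair_wf_digraph (cycle_graph k)"
  by unfold_locales (auto simp: cycle_graph_def)

text \<open>A walk that never turns straight back must revisit a vertex, and the first revisit
  closes a cycle. The last conclusion describes all neighbours in \<open>G\<close> of the vertices
  on it, so the cycle is a whole component.\<close>

lemma exists_cycle_parametrization: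
  assumes "pair_graph G" and deg: "\<And>v. v \<in> pverts G \<Longrightarrow> card (parcs G `` {v}) = 2"
    and "pverts G \<noteq> {}"
  obtains k x where "3 \<le> k" "inj_on x {..<k}" "x ` {..<k} \<subseteq> pverts G"
    "\<And>i w. i < k \<Longrightarrow>
      (x i, w) \<in> parcs G \<longleftrightarrow> (\<exists>j. w = x j \<and> (i, j) \<in> parcs (cycle_graph k))"
proof -
  interpret pair_graph G by fact
  let ?E = "parcs G"
  have ex_other: "\<exists>w. (v, w) \<in> ?E \<and> w \<noteq> u" if "v \<in> pverts G" for u v
  proof (rule ccontr)
    assume "\<not> ?thesis"
    then have "?E `` {v} \<subseteq> {u}" by blast
    then show False using deg[OF that] card_mono[of "{u}" "?E `` {v}"] by simp
  qed
  \<comment> \<open>Arcs are chosen rather than vertices, because avoiding a turn back depends on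
    the previous vertex as well as on the current one.\<close>
  obtain f where f: "\<And>n. f n \<in> ?E"
    "\<And>n. fst (f (Suc n)) = snd (f n) \<and> snd (f (Suc n)) \<noteq> fst (f n)"
  proof -
    have "\<exists>f. \<forall>n. f n \<in> ?E \<and> (fst (f (Suc n)) = snd (f n) \<and> snd (f (Suc n)) \<noteq> fst (f n))"
    proof (rule dependent_nat_choice)
      show "\<exists>e. e \<in> ?E" using ex_other assms(3) by blast
      fix e :: "'a \<times> 'a" and n :: nat assume "e \<in> ?E"
      then obtain w where "(snd e, w) \<in> ?E" "w \<noteq> fst e"
        using ex_other[of "snd e" "fst e"] arc_snd_in_verts by blast
      then show "\<exists>e'. e' \<in> ?E \<and> fst e' = snd e \<and> snd e' \<noteq> fst e" by force
    qed
    then show ?thesis using that by blast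
  qed
  define x where "x n = fst (f n)" for n
  have step: "(x n, x (Suc n)) \<in> ?E" for n
    using f[of n] unfolding x_def by (metis prod.collapse)
  have xV: "x n \<in> pverts G" for n using step in_arcsD1 by blast
  have ne: "x (Suc (Suc n)) \<noteq> x n" for n using f(2)[of n] f(2)[of "Suc n"] by (simp add: x_def)
  have N_eqI: "?E `` {v} = {a, b}" if "(v, a) \<in> ?E" "(v, b) \<in> ?E" "a \<noteq> b" for v a b
  proof -
    have "card (?E `` {v}) = 2" using that deg in_arcsD1 by blast
    then have "finite (?E `` {v})" by (metis card.infinite zero_neq_numeral)
    moreover have "{a, b} \<subseteq> ?E `` {v}" using that by auto
    ultimately have "{a, b} = ?E `` {v}"
      using \<open>card (?E `` {v}) = 2\<close> that(3) by (intro card_subset_eq) auto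
    then show ?thesis by simp
  qed
  have N_Suc: "?E `` {x (Suc n)} = {x n, x (Suc (Suc n))}" for n
    using step ne[of n] arcs_symmetric by (intro N_eqI) (auto simp: eq_commute)
  have "\<not> inj x"
    using pair_finite_verts xV by (meson finite_subset image_subsetI infinite_UNIV_nat inj_on_finite)
  then have ex: "\<exists>k. \<exists>i<k. x i = x k" by (metis injI linorder_neqE_nat)
  \<comment> \<open>The first time at which a vertex recurs; minimality makes \<open>x\<close>
    injective before it.\<close>
  define k where "k = (LEAST k. \<exists>i<k. x i = x k)"
  obtain i where i: "i < k" "x i = x k" using LeastI_ex[OF ex] unfolding k_def by blast
  have inj: "inj_on x {..<k}"
  proof (rule linorder_inj_onI)
    fix a b assume "a < b" "b \<in> {..<k}"
    then show "x a \<noteq> x b" using not_less_Least[of b "\<lambda>k. \<exists>i<k. x i = x k"] unfolding k_def by auto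
  qed auto
  \<comment> \<open>If the recurring vertex had a predecessor \<open>x l\<close>, then
    \<open>x r\<close>, the vertex just before the recurrence, would be one of its two neighbours
    \<open>x l\<close> and \<open>x (Suc i)\<close>. Injectivity rules out the first, and the second
    would be a turn back.\<close>
  have "i = 0"
  proof (rule ccontr)
    assume "i \<noteq> 0"
    then obtain l where l: "i = Suc l" using not0_implies_Suc by blast
    obtain r where r: "k = Suc r" using i(1) by (cases k) auto
    have "(x i, x r) \<in> ?E" using step[of r] arcs_symmetric i(2) r by metis
    then have "x r = x l \<or> x r = x (Suc i)" using N_Suc[of l] l by blast
    moreover have "r \<noteq> i" using step[of i] i(2) r no_loops' by auto
    ultimately have "r = l \<or> r = Suc i"
      using inj i(1) r l by (auto simp: inj_on_eq_iff)
    then show False using ne[of i] i l r by auto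
  qed
  then have xk: "x k = x 0" and "0 < k" using i by auto
  \<comment> \<open>Length 1 would be a loop and length 2 a turn back.\<close>
  have "k \<noteq> 1" using no_loops'[OF step[of 0]] xk by auto
  moreover have "k \<noteq> 2" using ne[of 0] xk by (auto simp: numeral_2_eq_2)
  ultimately have k: "3 \<le> k" using \<open>0 < k\<close> by linarith
  \<comment> \<open>The cyclic predecessor needs a case distinction because subtraction on naturals
    truncates at 0.\<close>
  have N: "?E `` {x i} = {x (Suc i mod k), x (if i = 0 then k - 1 else i - 1)}" if "i < k" for i
  proof (cases i)
    case 0
    have "(x (k - 1), x 0) \<in> ?E" using step[of "k - 1"] xk \<open>0 < k\<close> by simp
    then have "(x 0, x (k - 1)) \<in> ?E" by (rule arcs_symmetric)
    moreover have "x 1 \<noteq> x (k - 1)" using inj k by (simp add: inj_on_eq_iff)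
    ultimately show ?thesis using 0 step[of 0] k N_eqI[of "x 0" "x 1" "x (k - 1)"] by simp
  next
    case (Suc l)
    have "x (Suc i mod k) = x (Suc i)" using that xk by (cases "Suc i = k") auto
    then show ?thesis using N_Suc[of l] Suc by auto
  qed
  have arcs: "(x i, w) \<in> ?E \<longleftrightarrow> (\<exists>j. w = x j \<and> (i, j) \<in> parcs (cycle_graph k))" if "i < k" for i w
  proof -
    have cyc: "(i, j) \<in> parcs (cycle_graph k)
        \<longleftrightarrow> j = Suc i mod k \<or> j = (if i = 0 then k - 1 else i - 1)" for j
    proof (cases "j < k")
      case True
      have "i = Suc j mod k \<longleftrightarrow> j = (if i = 0 then k - 1 else i - 1)"
        using True \<open>i < k\<close> by (cases "Suc j = k") auto
      moreover have "(i, j) \<in> parcs (cycle_graph k) \<longleftrightarrow> j = Suc i mod k \<or> i = Suc j mod k"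
        using True \<open>i < k\<close> by (simp add: cycle_graph_def)
      ultimately show ?thesis by blast
    next
      case False
      moreover have "Suc i mod k < k" "(if i = 0 then k - 1 else i - 1) < k"
        using \<open>i < k\<close> by auto
      ultimately show ?thesis by (auto simp: cycle_graph_def)
    qed
    have mem: "(x i, w) \<in> ?E \<longleftrightarrow> w \<in> {x (Suc i mod k), x (if i = 0 then k - 1 else i - 1)}"
      using N[OF that] by blast
    show ?thesis unfolding mem cyc by blast
  qed
  show ?thesis using k inj arcs xV by (intro that) auto
qed

text \<open>Induction on the number of vertices, removing one cycle each time. Each cycle is indexed
  by one of its own vertices, which keeps the index type fixed and every new index fresh.\<close>

lemma two_regular_iso_union_cycles:
  fixes G :: "'a pair_pre_digraph"
  assumes "pair_graph G" and "\<And>v. v \<in> pverts G \<Longrightarrow> card (parcs G `` {v}) = 2"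
  shows "\<exists>(I :: 'a set) k. I \<subseteq> pverts G \<and> (\<forall>i\<in>I. 3 \<le> k i)
    \<and> indexed_union I (\<lambda>i. cycle_graph (k i)) \<simeq>\<^sub>g G"
  using assms
proof (induction "card (pverts G)" arbitrary: G rule: less_induct)
  case less
  interpret pair_graph G by (rule less.prems)
  show ?case
  proof (cases "pverts G = {}")
    case True
    have "indexed_union ({} :: 'a set) (\<lambda>i. cycle_graph 0) \<simeq>\<^sub>g G"
    proof (rule graph_isoI[where f=undefined])
      show "pair_wf_digraph (indexed_union ({} :: 'a set) (\<lambda>i. cycle_graph 0))"
        by (rule pair_wf_digraph_indexed_union) simp
      show "pair_wf_digraph G" by unfold_locales
    qed (simp_all add: True indexed_union_simps bij_betw_def)
    then show ?thesis by (intro exI[of _ "{}"] exI[of _ "\<lambda>_. 0"]) simp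
  next
    case False
    obtain k x where k: "3 \<le> k" and inj: "inj_on x {..<k}" and xV: "x ` {..<k} \<subseteq> pverts G"
      and arcs: "\<And>i w. i < k \<Longrightarrow>
        (x i, w) \<in> parcs G \<longleftrightarrow> (\<exists>j. w = x j \<and> (i, j) \<in> parcs (cycle_graph k))"
      using exists_cycle_parametrization[OF less.prems False] by blast
    define C where "C = x ` {..<k}"
    define G' where "G' = \<lparr>pverts = pverts G - C, parcs = parcs G \<inter> (pverts G - C) \<times> (pverts G - C)\<rparr>"
    \<comment> \<open>No arc leaves \<open>C\<close>, so deleting it leaves all remaining
      neighbourhoods intact and the rest is again 2-regular.\<close>
    have closed: "w \<in> C" if v: "v \<in> C" and vw: "(v, w) \<in> parcs G" for v w
    proof -
      obtain i where "i < k" "v = x i" using v by (auto simp: C_def)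
      then obtain j where "w = x j" "(i, j) \<in> parcs (cycle_graph k)" using arcs vw by blast
      then show ?thesis by (auto simp: C_def cycle_graph_def)
    qed
    have x0: "x 0 \<in> C" using k by (auto simp: C_def)
    have G': "pair_graph G'"
    proof unfold_locales
      show "symmetric (with_proj G')"
        unfolding symmetric_def sym_def with_proj_simps G'_def
        using arcs_symmetric by simp
    qed (use no_loops' in \<open>auto simp: G'_def pair_finite_verts pair_finite_arcs\<close>)
    have N': "parcs G' `` {v} = parcs G `` {v}" if "v \<in> pverts G'" for v
    proof
      show "parcs G' `` {v} \<subseteq> parcs G `` {v}" by (auto simp: G'_def)
      show "parcs G `` {v} \<subseteq> parcs G' `` {v}"
      proof
        fix w assume "w \<in> parcs G `` {v}"
        then have vw: "(v, w) \<in> parcs G" by simp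
        have v: "v \<in> pverts G" "v \<notin> C" using that by (auto simp: G'_def)
        then have "w \<notin> C" using closed arcs_symmetric[OF vw] by blast
        then show "w \<in> parcs G' `` {v}" using v vw in_arcsD2[OF vw] by (simp add: G'_def)
      qed
    qed
    have "card (pverts G') < card (pverts G)"
      using x0 xV pair_finite_verts by (intro psubset_card_mono) (auto simp: G'_def C_def)
    moreover have "card (parcs G' `` {v}) = 2" if "v \<in> pverts G'" for v
      using N'[OF that] less.prems(2) that by (simp add: G'_def)
    ultimately obtain I :: "'a set" and k' where I: "I \<subseteq> pverts G'" "\<forall>i\<in>I. 3 \<le> k' i"
      and iso: "indexed_union I (\<lambda>i. cycle_graph (k' i)) \<simeq>\<^sub>g G'"
      using less.hyps[OF _ G'] by blast
    let ?U = "indexed_union I (\<lambda>i. cycle_graph (k' i))"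
    obtain f where f: "bij_betw f (pverts ?U) (pverts G')" and
      farcs: "map_prod f f ` parcs ?U = parcs G'"
      using iso by (rule graph_isoE)
    have farc: "(p, q) \<in> parcs ?U \<longleftrightarrow> (f p, f q) \<in> parcs G'"
      if "p \<in> pverts ?U" "q \<in> pverts ?U" for p q
    proof
      show "(p, q) \<in> parcs ?U \<Longrightarrow> (f p, f q) \<in> parcs G'" using farcs by force
      assume "(f p, f q) \<in> parcs G'"
      then obtain p' q' where pq: "(p', q') \<in> parcs ?U" "f p = f p'" "f q = f q'"
        using farcs by force
      moreover have "p' \<in> pverts ?U" "q' \<in> pverts ?U"
        using pq(1) pair_wf_digraph_indexed_union[of I "\<lambda>i. cycle_graph (k' i)"]
          pair_wf_digraph_cycle_graph pair_wf_digraph.in_arcsD1 pair_wf_digraph.in_arcsD2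
        by metis+
      ultimately show "(p, q) \<in> parcs ?U"
        using f that by (metis bij_betw_imp_inj_on inj_on_eq_iff)
    qed
    have notin: "x 0 \<notin> I" using I x0 by (auto simp: G'_def)
    let ?k = "k'(x 0 := k)"
    let ?W = "indexed_union (insert (x 0) I) (\<lambda>i. cycle_graph (?k i))"
    \<comment> \<open>The cycle parametrization on the new component, the isomorphism from the
      induction hypothesis on the others.\<close>
    let ?g = "\<lambda>p. if fst p = x 0 then x (snd p) else f p"
    have W: "pverts ?W = {x 0} \<times> {..<k} \<union> pverts ?U"
      using notin by (auto simp: indexed_union_simps cycle_graph_def split: if_splits)
    have fstU: "fst p \<noteq> x 0" if "p \<in> pverts ?U" for p
      using that notin by (auto simp: indexed_union_simps)
    have fG': "f p \<in> pverts G - C" if "p \<in> pverts ?U" for p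
      using f that by (auto simp: bij_betw_def G'_def)
    have "?W \<simeq>\<^sub>g G"
    proof (rule graph_isoI[where f="?g"])
      show "pair_wf_digraph ?W"
        by (intro pair_wf_digraph_indexed_union pair_wf_digraph_cycle_graph)
      show "pair_wf_digraph G" by unfold_locales
      have "bij_betw ?g ({x 0} \<times> {..<k}) C"
      proof (rule bij_betw_imageI)
        show "inj_on ?g ({x 0} \<times> {..<k})" using inj by (auto simp: inj_on_def)
        have "?g ` ({x 0} \<times> {..<k}) = (\<lambda>p. x (snd p)) ` ({x 0} \<times> {..<k})"
          by (rule image_cong) auto
        also have "\<dots> = C" unfolding C_def by force
        finally show "?g ` ({x 0} \<times> {..<k}) = C" .
      qed
      moreover have "bij_betw ?g (pverts ?U) (pverts G')"
        using f fstU by (subst bij_betw_cong[where g=f]) auto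
      ultimately have "bij_betw ?g ({x 0} \<times> {..<k} \<union> pverts ?U) (C \<union> pverts G')"
        by (rule bij_betw_combine) (auto simp: G'_def)
      moreover have "C \<union> pverts G' = pverts G" using xV by (auto simp: G'_def C_def)
      ultimately show "bij_betw ?g (pverts ?W) (pverts G)" using W by simp
      fix p q assume "p \<in> pverts ?W" "q \<in> pverts ?W"
      then consider i j where "p = (x 0, i)" "q = (x 0, j)" "i < k" "j < k"
        | i where "p = (x 0, i)" "i < k" "q \<in> pverts ?U"
        | j where "q = (x 0, j)" "j < k" "p \<in> pverts ?U"
        | "p \<in> pverts ?U" "q \<in> pverts ?U"
        unfolding W by auto
      then show "(p, q) \<in> parcs ?W \<longleftrightarrow> (?g p, ?g q) \<in> parcs G"
      proof cases
        case (1 i j)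
        have "(\<exists>j'. x j = x j' \<and> (i, j') \<in> parcs (cycle_graph k)) \<longleftrightarrow> (i, j) \<in> parcs (cycle_graph k)"
          using inj 1 by (auto simp: inj_on_def cycle_graph_def)
        then show ?thesis using 1 arcs by (simp add: indexed_union_simps)
      next
        case (2 i)
        have "x i \<in> C" using 2 by (auto simp: C_def)
        then have "(x i, f q) \<notin> parcs G" using closed fG' 2 by blast
        then show ?thesis using 2 fstU[of q] by (cases q) (auto simp: indexed_union_simps)
      next
        case (3 j)
        have "x j \<in> C" using 3 by (auto simp: C_def)
        then have "(f p, x j) \<notin> parcs G" using closed fG' 3 arcs_symmetric by blast
        then show ?thesis using 3 fstU[of p] by (cases p) (auto simp: indexed_union_simps)
      next
        case 4
        have "(p, q) \<in> parcs ?W \<longleftrightarrow> (p, q) \<in> parcs ?U"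
          using 4 fstU[of p] fstU[of q] by (cases p, cases q) (auto simp: indexed_union_simps)
        also have "\<dots> \<longleftrightarrow> (f p, f q) \<in> parcs G'" using 4 by (rule farc)
        also have "\<dots> \<longleftrightarrow> (f p, f q) \<in> parcs G" using fG' 4 by (auto simp: G'_def)
        finally show ?thesis using 4 fstU by simp
      qed
    qed
    moreover have "insert (x 0) I \<subseteq> pverts G" using I x0 xV by (auto simp: G'_def C_def)
    moreover have "\<forall>i\<in>insert (x 0) I. 3 \<le> ?k i" using k I by auto
    ultimately show ?thesis by blast
  qed
qed

section \<open>Homomorphisms from cycles\<close>

text \<open>The maps counted by \<open>walk_count\<close>. A walk with \<open>k\<close> arcs has
  \<open>k + 1\<close> positions, so a closed walk repeats its starting vertex at position
  \<open>k\<close>.\<close>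

definition walk_maps :: "'b pair_pre_digraph \<Rightarrow> nat \<Rightarrow> 'b \<Rightarrow> 'b \<Rightarrow> (nat \<Rightarrow> 'b) set" where
  "walk_maps H k i j =
    {f \<in> {..k} \<rightarrow>\<^sub>E pverts H. f 0 = i \<and> f k = j \<and> (\<forall>l<k. (f l, f (Suc l)) \<in> parcs H)}"

lemma finite_walk_maps: "finite (pverts H) \<Longrightarrow> finite (walk_maps H k i j)"
  unfolding walk_maps_def by (rule finite_subset[OF _ finite_PiE[of "{..k}"]]) auto

context pair_pseudo_graph begin

text \<open>Splitting a walk at its last vertex before \<open>j\<close> mirrors the recursion of
  \<open>walk_count\<close>.\<close>

lemma card_walk_maps:
  assumes "i \<in> pverts G" "j \<in> pverts G"
  shows "real (card (walk_maps G k i j)) = walk_count G k i j"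
  using assms(2)
proof (induction k arbitrary: j)
  case 0
  have "walk_maps G 0 i j = (if i = j then {\<lambda>l\<in>{0}. i} else {})"
    using assms(1) by (auto simp: walk_maps_def PiE_iff extensional_def fun_eq_iff)
  then show ?case by simp
next
  case (Suc k)
  let ?M = "{m \<in> pverts G. (m, j) \<in> parcs G}"
  have "bij_betw (\<lambda>f. (f k, restrict f {..k})) (walk_maps G (Suc k) i j) (SIGMA m:?M. walk_maps G k i m)"
  proof (rule bij_betw_byWitness[where f'="\<lambda>(m, f). f(Suc k := j)"])
    show "\<forall>f\<in>walk_maps G (Suc k) i j. (\<lambda>(m, f). f(Suc k := j)) (f k, restrict f {..k}) = f"
      by (auto simp: walk_maps_def PiE_iff extensional_def fun_eq_iff)
    show "\<forall>p\<in>SIGMA m:?M. walk_maps G k i m.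
        (((\<lambda>(m, f). f(Suc k := j)) p) k, restrict ((\<lambda>(m, f). f(Suc k := j)) p) {..k}) = p"
      by (auto simp: walk_maps_def PiE_iff extensional_def fun_eq_iff)
    show "(\<lambda>f. (f k, restrict f {..k})) ` walk_maps G (Suc k) i j \<subseteq> (SIGMA m:?M. walk_maps G k i m)"
      by (auto simp: walk_maps_def PiE_iff)
    show "(\<lambda>(m, f). f(Suc k := j)) ` (SIGMA m:?M. walk_maps G k i m) \<subseteq> walk_maps G (Suc k) i j"
      using Suc.prems by (auto simp: walk_maps_def PiE_iff extensional_def less_Suc_eq)
  qed
  then have "card (walk_maps G (Suc k) i j) = (\<Sum>m\<in>?M. card (walk_maps G k i m))"
    using pair_finite_verts
    by (simp add: bij_betw_same_card card_SigmaI finite_walk_maps)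
  also have "real \<dots> = (\<Sum>m\<in>?M. walk_count G k i m)" using Suc.IH by simp
  also have "\<dots> = walk_count G (Suc k) i j"
    using pair_finite_verts by (simp add: sum_mult_of_bool_eq Collect_conj_eq)
  finally show ?case .
qed

text \<open>A homomorphism from a cycle is unrolled into a closed walk by repeating the value at 0
  in position \<open>k\<close>. At \<open>k = 0\<close> this fails: there is one empty map, but one
  closed walk per vertex.\<close>

lemma hom_count_cycle_graph:
  assumes "0 < k"
  shows "real (hom_count (cycle_graph k) G) = closed_walks G k"
proof -
  have arc: "(i, Suc i mod k) \<in> parcs (cycle_graph k)" if "i < k" for i
    using that by (auto simp: cycle_graph_def)
  have "bij_betw (\<lambda>f. (f 0, f(k := f 0))) (graph_homs (cycle_graph k) G)
    (SIGMA i:pverts G. walk_maps G k i i)"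
  proof (rule bij_betw_byWitness[where f'="\<lambda>(i, f). restrict f {..<k}"])
    show "\<forall>f\<in>graph_homs (cycle_graph k) G. (\<lambda>(i, f). restrict f {..<k}) (f 0, f(k := f 0)) = f"
      by (auto simp: graph_homs_def cycle_graph_def PiE_iff extensional_def fun_eq_iff)
    show "\<forall>p\<in>SIGMA i:pverts G. walk_maps G k i i. (((\<lambda>(i, f). restrict f {..<k}) p) 0,
        ((\<lambda>(i, f). restrict f {..<k}) p)(k := ((\<lambda>(i, f). restrict f {..<k}) p) 0)) = p"
      using assms by (auto simp: walk_maps_def PiE_iff extensional_def fun_eq_iff)
    show "(\<lambda>f. (f 0, f(k := f 0))) ` graph_homs (cycle_graph k) G
        \<subseteq> (SIGMA i:pverts G. walk_maps G k i i)"
    proof (safe; clarsimp?)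
      fix f assume f: "f \<in> graph_homs (cycle_graph k) G"
      then have "f \<in> {..<k} \<rightarrow>\<^sub>E pverts G" by (simp add: graph_homs_def cycle_graph_def)
      moreover have "(f l, (f(k := f 0)) (Suc l)) \<in> parcs G" if "l < k" for l
      proof -
        have "(f l, f (Suc l mod k)) \<in> parcs G"
          using f arc[OF that] unfolding graph_homs_def by blast
        then show ?thesis using that by (cases "Suc l = k") auto
      qed
      ultimately have f0: "f 0 \<in> pverts G" and fE: "f \<in> {..<k} \<rightarrow>\<^sub>E pverts G"
        and step: "\<And>l. l < k \<Longrightarrow> (f l, (f(k := f 0)) (Suc l)) \<in> parcs G"
        using assms by blast+
      show "f 0 \<in> pverts G" by (rule f0)
      have "f(k := f 0) \<in> insert k {..<k} \<rightarrow>\<^sub>E pverts G" using f0 fE by (rule PiE_fun_upd)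
      moreover have "insert k {..<k} = {..k}" by auto
      moreover have "((f(k := f 0)) l, (f(k := f 0)) (Suc l)) \<in> parcs G" if "l < k" for l
        using step[OF that] that fun_upd_other[of l k f "f 0"] by simp
      ultimately show "f(k := f 0) \<in> walk_maps G k (f 0) (f 0)"
        using assms unfolding walk_maps_def by simp
    qed
    show "(\<lambda>(i, f). restrict f {..<k}) ` (SIGMA i:pverts G. walk_maps G k i i)
        \<subseteq> graph_homs (cycle_graph k) G"
    proof (safe; clarsimp?)
      fix i f assume f: "f \<in> walk_maps G k i i"
      have step: "(f l, f (Suc l mod k)) \<in> parcs G" if "l < k" for l
        using f that by (cases "Suc l = k") (auto simp: walk_maps_def)
      \<comment> \<open>The walk provides only forward arcs; symmetry of the target provides the
        backward arcs of the cycle.\<close>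
      have "(f u, f v) \<in> parcs G" if "(u, v) \<in> parcs (cycle_graph k)" for u v
        using that step arcs_symmetric by (auto simp: cycle_graph_def)
      then show "restrict f {..<k} \<in> graph_homs (cycle_graph k) G"
        using f by (auto simp: graph_homs_def walk_maps_def PiE_iff cycle_graph_def)
    qed
  qed
  then have "hom_count (cycle_graph k) G = (\<Sum>i\<in>pverts G. card (walk_maps G k i i))"
    unfolding hom_count_def using pair_finite_verts
    by (simp add: bij_betw_same_card card_SigmaI finite_walk_maps)
  then show ?thesis by (simp add: closed_walks_def card_walk_maps)
qed

end

section \<open>Growth rate per vertex, and comparison of products over cycles\<close>

lemma prod_eq_iff_eq_of_le:
  fixes f g :: "'i \<Rightarrow> real"
  assumes "finite I" and le: "\<And>i. i \<in> I \<Longrightarrow> 0 \<le> f i \<and> f i \<le> g i"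
    and pos: "\<And>i. i \<in> I \<Longrightarrow> 0 < g i"
  shows "prod f I = prod g I \<longleftrightarrow> (\<forall>i\<in>I. f i = g i)"
proof (rule iffI, rule ccontr)
  assume eq: "prod f I = prod g I" and "\<not> (\<forall>i\<in>I. f i = g i)"
  then obtain i where i: "i \<in> I" "f i < g i" using le by force
  have "prod f I = f i * prod f (I - {i})" using assms(1) i by (simp add: prod.remove)
  also have "\<dots> \<le> f i * prod g (I - {i})"
    using le i by (intro mult_left_mono prod_mono) auto
  also have "\<dots> < g i * prod g (I - {i})"
    using pos i by (intro mult_strict_right_mono prod_pos) auto
  also have "\<dots> = prod g I" using assms(1) i by (simp add: prod.remove)
  finally show False using eq by simp
qed simp

text \<open>The exponent 0 is excluded because \<open>0 powr 0\<close> is 0, whereas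
  \<open>0 ^ 0\<close> is 1.\<close>

lemma powr_divide_power:
  fixes x :: real
  assumes "n \<noteq> 0"
  shows "x powr (real n / m) = (x powr (1 / m)) ^ n"
  using assms by (cases "x = 0") (simp_all add: powr_power)

text \<open>The best contribution per vertex. Bounding each cycle by this rate to the power of its
  length makes the product over components depend only on the total number of vertices.\<close>

definition cycle_rate :: "'b pair_pre_digraph \<Rightarrow> real" where
  "cycle_rate H = max (real (hom_count (cycle_graph 3) H) powr (1 / 3))
    (real (hom_count (cycle_graph 4) H) powr (1 / 4))"

context pair_pseudo_graph begin

lemma hom_count_cycle_3_eq:
  "real (hom_count (cycle_graph 3) G) = (real (hom_count (cycle_graph 3) G) powr (1 / 3)) ^ 3"
  using powr_divide_power[of 3 "real (hom_count (cycle_graph 3) G)" 3] by simp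

lemma hom_count_cycle_4_eq:
  "real (hom_count (cycle_graph 4) G) = (real (hom_count (cycle_graph 4) G) powr (1 / 4)) ^ 4"
  using powr_divide_power[of 4 "real (hom_count (cycle_graph 4) G)" 4] by simp

lemma hom_count_cycle_le_power:
  assumes "4 \<le> k"
  shows "real (hom_count (cycle_graph k) G) \<le> (real (hom_count (cycle_graph 4) G) powr (1 / 4)) ^ k"
    (is "_ \<le> ?b ^ k")
proof -
  have "real (hom_count (cycle_graph k) G) ^ 4 \<le> real (hom_count (cycle_graph 4) G) ^ k"
    using closed_walks_power4_le[OF assms] assms by (simp add: hom_count_cycle_graph)
  also have "\<dots> = (?b ^ 4) ^ k" using hom_count_cycle_4_eq by simp
  also have "\<dots> = (?b ^ k) ^ 4" by (simp add: mult.commute flip: power_mult)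
  \<comment> \<open>The rule has its exponent in the form \<open>Suc n\<close>, so 3 stands for the
    fourth power.\<close>
  finally show ?thesis by (rule power_le_imp_le_base[of _ 3, simplified]) simp
qed

lemma hom_count_cycle_less_power:
  assumes "0 < closed_walks G 4" "closed_walks G 8 < (closed_walks G 4)\<^sup>2" "5 \<le> k"
  shows "real (hom_count (cycle_graph k) G) < (real (hom_count (cycle_graph 4) G) powr (1 / 4)) ^ k"
    (is "_ < ?b ^ k")
proof -
  have "real (hom_count (cycle_graph k) G) ^ 4 < real (hom_count (cycle_graph 4) G) ^ k"
    using closed_walks_power4_less[OF assms] assms by (simp add: hom_count_cycle_graph)
  also have "\<dots> = (?b ^ 4) ^ k" using hom_count_cycle_4_eq by simp
  also have "\<dots> = (?b ^ k) ^ 4" by (simp add: mult.commute flip: power_mult)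
  finally show ?thesis by (rule power_less_imp_less_base) simp
qed

lemma hom_count_cycle_le_rate:
  assumes "3 \<le> k"
  shows "real (hom_count (cycle_graph k) G) \<le> cycle_rate G ^ k"
proof (cases "k = 3")
  case True
  then show ?thesis
    by (subst True, subst hom_count_cycle_3_eq) (auto simp: cycle_rate_def intro!: power_mono)
next
  case False
  have "real (hom_count (cycle_graph k) G) \<le> (real (hom_count (cycle_graph 4) G) powr (1 / 4)) ^ k"
    using assms False by (intro hom_count_cycle_le_power) auto
  also have "\<dots> \<le> cycle_rate G ^ k" by (intro power_mono) (auto simp: cycle_rate_def)
  finally show ?thesis .
qed

lemma cycle_rate_pos:
  assumes "0 < closed_walks G 4"
  shows "0 < cycle_rate G"
  using assms hom_count_cycle_graph[of 4] by (auto simp: cycle_rate_def less_max_iff_disj)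

text \<open>Lengths from 5 on fall strictly below the rate. For lengths 3 and 4 both sides are
  powers with the same exponent, so their bases can be compared.\<close>

lemma hom_count_cycle_eq_rate_iff:
  assumes "0 < closed_walks G 4" "closed_walks G 8 < (closed_walks G 4)\<^sup>2" "3 \<le> k"
  shows "real (hom_count (cycle_graph k) G) = cycle_rate G ^ k \<longleftrightarrow>
    k = 3 \<and> real (hom_count (cycle_graph 3) G) powr (1 / 3) = cycle_rate G \<or>
    k = 4 \<and> real (hom_count (cycle_graph 4) G) powr (1 / 4) = cycle_rate G"
proof -
  consider "k = 3" | "k = 4" | "5 \<le> k" using assms(3) by linarith
  then show ?thesis
  proof cases
    case 1
    have "real (hom_count (cycle_graph 3) G) = cycle_rate G ^ 3
        \<longleftrightarrow> real (hom_count (cycle_graph 3) G) powr (1 / 3) = cycle_rate G"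
      using cycle_rate_pos[OF assms(1)]
      by (subst hom_count_cycle_3_eq) (simp add: power_eq_iff_eq_base)
    then show ?thesis using 1 by simp
  next
    case 2
    have "real (hom_count (cycle_graph 4) G) = cycle_rate G ^ 4
        \<longleftrightarrow> real (hom_count (cycle_graph 4) G) powr (1 / 4) = cycle_rate G"
      using cycle_rate_pos[OF assms(1)]
      by (subst hom_count_cycle_4_eq) (simp add: power_eq_iff_eq_base)
    then show ?thesis using 2 by simp
  next
    case 3
    have "real (hom_count (cycle_graph k) G) < (real (hom_count (cycle_graph 4) G) powr (1 / 4)) ^ k"
      using assms 3 by (intro hom_count_cycle_less_power)
    also have "\<dots> \<le> cycle_rate G ^ k" by (intro power_mono) (auto simp: cycle_rate_def)
    finally show ?thesis using 3 by simp
  qed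
qed

lemma max_hom_count_powr_eq_rate_power:
  assumes "0 < closed_walks G 4"
  shows "max (real (hom_count (cycle_graph 3) G) powr (real n / 3))
    (real (hom_count (cycle_graph 4) G) powr (real n / 4)) = cycle_rate G ^ n"
proof (cases "n = 0")
  case True
  \<comment> \<open>If there is no homomorphism from the triangle, its term is
    \<open>0 powr 0 = 0\<close>; positivity of the count for length 4 still makes the maximum
    1.\<close>
  then show ?thesis using assms hom_count_cycle_graph[of 4] by simp
next
  case False
  then have "real (hom_count (cycle_graph 3) G) powr (real n / 3)
        = (real (hom_count (cycle_graph 3) G) powr (1 / 3)) ^ n"
    "real (hom_count (cycle_graph 4) G) powr (real n / 4)
        = (real (hom_count (cycle_graph 4) G) powr (1 / 4)) ^ n"
    by (simp_all add: powr_divide_power)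
  then show ?thesis
    unfolding cycle_rate_def
    by (auto simp: max_def power_mono intro!: antisym)
qed

text \<open>Both sides become products over the cycles, since homomorphism counts multiply and the
  lengths add up in the exponent. The bound and its equality case are then checked one cycle at a
  time.\<close>

lemma
  assumes iso: "indexed_union I (\<lambda>i. cycle_graph (k i)) \<simeq>\<^sub>g F" and "finite I"
    and k: "\<And>i. i \<in> I \<Longrightarrow> 3 \<le> k i"
  shows hom_count_cycles_le: "real (hom_count F G) \<le> cycle_rate G ^ card (pverts F)"
    and hom_count_cycles_eq_iff:
      "0 < closed_walks G 4 \<Longrightarrow> closed_walks G 8 < (closed_walks G 4)\<^sup>2 \<Longrightarrow>
        real (hom_count F G) = cycle_rate G ^ card (pverts F) \<longleftrightarrow>
        (\<forall>i\<in>I. k i = 3 \<and> real (hom_count (cycle_graph 3) G) powr (1 / 3) = cycle_rate G \<or>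
          k i = 4 \<and> real (hom_count (cycle_graph 4) G) powr (1 / 4) = cycle_rate G)"
proof -
  have "card (pverts F) = (\<Sum>i\<in>I. card (pverts (cycle_graph (k i))))"
    using card_pverts_graph_iso[OF iso] \<open>finite I\<close>
    by (simp add: card_pverts_indexed_union cycle_graph_def)
  then have rate: "cycle_rate G ^ card (pverts F) = (\<Prod>i\<in>I. cycle_rate G ^ k i)"
    by (simp add: cycle_graph_def power_sum)
  have "hom_count F G = (\<Prod>i\<in>I. hom_count (cycle_graph (k i)) G)"
    using hom_count_graph_iso[OF iso, of G] \<open>finite I\<close>
    by (simp add: hom_count_indexed_union pair_wf_digraph_cycle_graph)
  then have hom: "real (hom_count F G) = (\<Prod>i\<in>I. real (hom_count (cycle_graph (k i)) G))"
    by simp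
  show "real (hom_count F G) \<le> cycle_rate G ^ card (pverts F)"
    unfolding hom rate using k by (intro prod_mono) (auto intro: hom_count_cycle_le_rate)
  assume *: "0 < closed_walks G 4" "closed_walks G 8 < (closed_walks G 4)\<^sup>2"
  have "real (hom_count F G) = cycle_rate G ^ card (pverts F) \<longleftrightarrow>
      (\<forall>i\<in>I. real (hom_count (cycle_graph (k i)) G) = cycle_rate G ^ k i)"
    unfolding hom rate using \<open>finite I\<close> k cycle_rate_pos[OF *(1)]
    by (intro prod_eq_iff_eq_of_le) (auto intro: hom_count_cycle_le_rate)
  then show "real (hom_count F G) = cycle_rate G ^ card (pverts F) \<longleftrightarrow>
        (\<forall>i\<in>I. k i = 3 \<and> real (hom_count (cycle_graph 3) G) powr (1 / 3) = cycle_rate G \<or>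
          k i = 4 \<and> real (hom_count (cycle_graph 4) G) powr (1 / 4) = cycle_rate G)"
    using hom_count_cycle_eq_rate_iff[OF *] k by simp
qed

lemma complete_iso_looped_complete_graph:
  assumes "\<And>i j. i \<in> pverts G \<Longrightarrow> j \<in> pverts G \<Longrightarrow> (i, j) \<in> parcs G"
  shows "G \<simeq>\<^sub>g looped_complete_graph (card (pverts G))"
proof -
  obtain p where p: "bij_betw p (pverts G) {0..<card (pverts G)}"
    using pair_finite_verts ex_bij_betw_finite_nat by blast
  show ?thesis
  proof (rule graph_isoI[where f=p])
    show "pair_wf_digraph G" by unfold_locales
    show "pair_wf_digraph (looped_complete_graph (card (pverts G)))"
      by unfold_locales (auto simp: looped_complete_graph_def)
    show "bij_betw p (pverts G) (pverts (looped_complete_graph (card (pverts G))))"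
      using p by (simp add: looped_complete_graph_def lessThan_atLeast0)
    show "(u, v) \<in> parcs G \<longleftrightarrow> (p u, p v) \<in> parcs (looped_complete_graph (card (pverts G)))"
      if "u \<in> pverts G" "v \<in> pverts G" for u v
      using that assms p by (auto simp: looped_complete_graph_def bij_betw_def)
  qed
qed

end

section \<open>From families of cycles to copies of triangles and 4-cycles\<close>

lemma indexed_union_const_iso_copies:
  assumes "finite I" "pair_wf_digraph F" "\<And>i. i \<in> I \<Longrightarrow> F' i = F"
  shows "indexed_union I F' \<simeq>\<^sub>g copies (card I) F"
proof -
  obtain p where p: "bij_betw p I {..<card I}"
    using assms(1) ex_bij_betw_finite_nat lessThan_atLeast0 by metis
  show ?thesis unfolding copies_eq_indexed_union
    using p assms by (intro indexed_union_reindex[where p=p]) auto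
qed

lemma indexed_union_two_kinds_iso_disjoint_union_copies:
  assumes "finite I" "pair_wf_digraph F" "pair_wf_digraph F'"
    and "\<And>i. i \<in> I \<Longrightarrow> E i = (if P i then F else F')"
  shows "indexed_union I E
    \<simeq>\<^sub>g disjoint_union (copies (card {i \<in> I. P i}) F) (copies (card {i \<in> I. \<not> P i}) F')"
proof -
  obtain p where p: "bij_betw p {i \<in> I. P i} {..<card {i \<in> I. P i}}"
    using assms(1) ex_bij_betw_finite_nat lessThan_atLeast0 by (metis finite_Collect_conjI Collect_mem_eq)
  obtain q where q: "bij_betw q {i \<in> I. \<not> P i} {..<card {i \<in> I. \<not> P i}}"
    using assms(1) ex_bij_betw_finite_nat lessThan_atLeast0 by (metis finite_Collect_conjI Collect_mem_eq)
  have "bij_betw (\<lambda>i. if P i then Inl (p i) else Inr (q i)) I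
      ({..<card {i \<in> I. P i}} <+> {..<card {i \<in> I. \<not> P i}})"
    using p q by (auto simp: bij_betw_def inj_on_def image_iff set_eq_iff Plus_def)
  then have "indexed_union I E
      \<simeq>\<^sub>g indexed_union ({..<card {i \<in> I. P i}} <+> {..<card {i \<in> I. \<not> P i}})
        (case_sum (\<lambda>_. F) (\<lambda>_. F'))"
    using assms by (intro indexed_union_reindex) auto
  also have "\<dots> \<simeq>\<^sub>g disjoint_union (copies (card {i \<in> I. P i}) F) (copies (card {i \<in> I. \<not> P i}) F')"
    using assms by (intro indexed_union_iso_disjoint_union_copies)
  finally show ?thesis .
qed

theorem theorem1p1:
  fixes G :: "'a pair_pre_digraph" and H :: "'b pair_pre_digraph" and n :: nat
  assumes H: "pair_pseudo_graph H"
    and H_nonempty: "pverts H \<noteq> {}"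
    and no_isolated: "\<not> (\<exists>v. isolated_vertex H v)"
    and G: "pair_graph G"
    and n: "card (pverts G) = n"
    and two_regular: "\<forall>v \<in> pverts G. out_degree (with_proj G) v = 2"
  shows
    "real (hom_count G H) \<le>
       max (real (hom_count (cycle_graph 3) H) powr (real n / 3))
           (real (hom_count (cycle_graph 4) H) powr (real n / 4))
     \<and>
     ((\<forall>q\<ge>1. \<not> H \<simeq>\<^sub>g looped_complete_graph q) \<longrightarrow>
       (real (hom_count (cycle_graph 3) H) powr (1 / 3)
          > real (hom_count (cycle_graph 4) H) powr (1 / 4) \<longrightarrow>
        (real (hom_count G H) =
           max (real (hom_count (cycle_graph 3) H) powr (real n / 3))
               (real (hom_count (cycle_graph 4) H) powr (real n / 4))
         \<longleftrightarrow> 3 dvd n \<and> G \<simeq>\<^sub>g copies (n div 3) (cycle_graph 3))) \<and>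
       (real (hom_count (cycle_graph 3) H) powr (1 / 3)
          < real (hom_count (cycle_graph 4) H) powr (1 / 4) \<longrightarrow>
        (real (hom_count G H) =
           max (real (hom_count (cycle_graph 3) H) powr (real n / 3))
               (real (hom_count (cycle_graph 4) H) powr (real n / 4))
         \<longleftrightarrow> 4 dvd n \<and> G \<simeq>\<^sub>g copies (n div 4) (cycle_graph 4))) \<and>
       (real (hom_count (cycle_graph 3) H) powr (1 / 3)
          = real (hom_count (cycle_graph 4) H) powr (1 / 4) \<longrightarrow>
        (real (hom_count G H) =
           max (real (hom_count (cycle_graph 3) H) powr (real n / 3))
               (real (hom_count (cycle_graph 4) H) powr (real n / 4))
         \<longleftrightarrow> (\<exists>a b. G \<simeq>\<^sub>g disjoint_union (copies a (cycle_graph 3)) (copies b (cycle_graph 4))))))"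
proof -
  interpret H: pair_pseudo_graph H by (rule H)
  interpret G: pair_graph G by (rule G)
  have nbr: "parcs H `` {v} \<noteq> {}" if v: "v \<in> pverts H" for v
  proof -
    obtain e where "e \<in> parcs H" "fst e = v \<or> snd e = v"
      using no_isolated v unfolding isolated_vertex_def by blast
    then show ?thesis using H.arcs_symmetric by (cases e) auto
  qed
  have pos: "0 < closed_walks H 4"
  proof -
    obtain v where "v \<in> pverts H" using H_nonempty by blast
    then obtain w where "(v, w) \<in> parcs H" using nbr by blast
    then show ?thesis by (rule H.closed_walks_4_pos)
  qed
  let ?a = "real (hom_count (cycle_graph 3) H) powr (1 / 3)"
  let ?b = "real (hom_count (cycle_graph 4) H) powr (1 / 4)"
  have "card (parcs G `` {v}) = 2" if "v \<in> pverts G" for v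
  proof -
    have "out_arcs (with_proj G) v = Pair v ` (parcs G `` {v})" by (auto simp: out_arcs_def)
    then have "card (out_arcs (with_proj G) v) = card (parcs G `` {v})"
      by (simp add: card_image inj_on_def)
    then show ?thesis using two_regular that by (simp add: out_degree_def)
  qed
  then obtain I :: "'a set" and k where I: "I \<subseteq> pverts G" "\<forall>i\<in>I. 3 \<le> k i"
    and iso: "indexed_union I (\<lambda>i. cycle_graph (k i)) \<simeq>\<^sub>g G"
    using two_regular_iso_union_cycles[OF G] by blast
  have fin: "finite I" using I(1) G.pair_finite_verts by (rule finite_subset)
  have n_eq: "n = (\<Sum>i\<in>I. k i)"
    using card_pverts_graph_iso[OF iso] n fin
    by (simp add: card_pverts_indexed_union cycle_graph_def)
  have wf: "pair_wf_digraph (cycle_graph j)" for j by (rule pair_wf_digraph_cycle_graph)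
  note max_eq = H.max_hom_count_powr_eq_rate_power[OF pos, of n]
  have le: "real (hom_count G H) \<le> cycle_rate H ^ n"
    using H.hom_count_cycles_le[OF iso fin] I n by blast
  have copies_only: "3 \<le> m \<Longrightarrow> m dvd n \<and> G \<simeq>\<^sub>g copies (n div m) (cycle_graph m)"
    if "\<forall>i\<in>I. k i = m" for m
  proof -
    assume "3 \<le> m"
    have "n = card I * m" using n_eq that by simp
    moreover have "G \<simeq>\<^sub>g copies (card I) (cycle_graph m)"
      using that by (intro graph_iso_trans[OF graph_iso_sym[OF iso]]
        indexed_union_const_iso_copies fin wf) simp
    ultimately show ?thesis using \<open>3 \<le> m\<close> by simp
  qed
  show ?thesis unfolding max_eq
  proof (intro conjI impI le)
    assume "\<forall>q\<ge>1. \<not> H \<simeq>\<^sub>g looped_complete_graph q"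
    moreover have "1 \<le> card (pverts H)"
      using H_nonempty H.pair_finite_verts by (simp add: Suc_le_eq card_gt_0_iff)
    ultimately obtain u v where "u \<in> pverts H" "v \<in> pverts H" "(u, v) \<notin> parcs H"
      using H.complete_iso_looped_complete_graph by blast
    then have strict: "closed_walks H 8 < (closed_walks H 4)\<^sup>2"
      using nbr by (intro H.closed_walks_8_less)
    \<comment> \<open>The decomposition of \<open>G\<close> is left open: the criterion is applied
      both to the cycles found in \<open>G\<close> and to presentations of \<open>G\<close> by given
      copies.\<close>
    note eq_iff = H.hom_count_cycles_eq_iff[where F=G, OF _ _ _ pos strict, unfolded n]
    have eq_G: "real (hom_count G H) = cycle_rate H ^ n \<longleftrightarrow>
        (\<forall>i\<in>I. k i = 3 \<and> ?a = cycle_rate H \<or> k i = 4 \<and> ?b = cycle_rate H)"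
      using eq_iff[OF iso fin] I by simp
    \<comment> \<open>For the converse direction, the copies themselves serve as the cycle
      decomposition, indexed by \<open>{..<c}\<close>.\<close>
    have eq_copies: "real (hom_count G H) = cycle_rate H ^ n"
      if "G \<simeq>\<^sub>g copies c (cycle_graph m)" "m = 3 \<and> ?a = cycle_rate H \<or> m = 4 \<and> ?b = cycle_rate H"
      for c m
      using eq_iff[of "{..<c}" "\<lambda>_. m"] that graph_iso_sym
      unfolding copies_eq_indexed_union by fastforce
    show "real (hom_count G H) = cycle_rate H ^ n
        \<longleftrightarrow> 3 dvd n \<and> G \<simeq>\<^sub>g copies (n div 3) (cycle_graph 3)" if "?b < ?a"
    proof -
      \<comment> \<open>Only the triangle attains the rate here, so \<open>eq_G\<close> forces every
        cycle to have length 3.\<close>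
      have rate: "?a = cycle_rate H" "?b \<noteq> cycle_rate H" using that by (auto simp: cycle_rate_def)
      then show ?thesis using eq_G copies_only[of 3] eq_copies[of _ 3] by auto
    qed
    show "real (hom_count G H) = cycle_rate H ^ n
        \<longleftrightarrow> 4 dvd n \<and> G \<simeq>\<^sub>g copies (n div 4) (cycle_graph 4)" if "?a < ?b"
    proof -
      have rate: "?b = cycle_rate H" "?a \<noteq> cycle_rate H" using that by (auto simp: cycle_rate_def)
      then show ?thesis using eq_G copies_only[of 4] eq_copies[of _ 4] by auto
    qed
    show "real (hom_count G H) = cycle_rate H ^ n
        \<longleftrightarrow> (\<exists>a b. G \<simeq>\<^sub>g disjoint_union (copies a (cycle_graph 3)) (copies b (cycle_graph 4)))"
      if "?a = ?b"
    proof
      have rate: "?a = cycle_rate H" "?b = cycle_rate H" using that by (auto simp: cycle_rate_def)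
      {
        assume "real (hom_count G H) = cycle_rate H ^ n"
        then have "indexed_union I (\<lambda>i. cycle_graph (k i)) \<simeq>\<^sub>g disjoint_union
            (copies (card {i \<in> I. k i = 3}) (cycle_graph 3))
            (copies (card {i \<in> I. k i \<noteq> 3}) (cycle_graph 4))"
          using eq_G by (intro indexed_union_two_kinds_iso_disjoint_union_copies fin wf) auto
        then have "G \<simeq>\<^sub>g disjoint_union (copies (card {i \<in> I. k i = 3}) (cycle_graph 3))
            (copies (card {i \<in> I. k i \<noteq> 3}) (cycle_graph 4))"
          by (rule graph_iso_trans[OF graph_iso_sym[OF iso]])
        then show "\<exists>a b. G \<simeq>\<^sub>g disjoint_union (copies a (cycle_graph 3)) (copies b (cycle_graph 4))"
          by blast
      }
      assume "\<exists>a b. G \<simeq>\<^sub>g disjoint_union (copies a (cycle_graph 3)) (copies b (cycle_graph 4))"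
      then obtain a b where
        ab: "G \<simeq>\<^sub>g disjoint_union (copies a (cycle_graph 3)) (copies b (cycle_graph 4))" by blast
      \<comment> \<open>Cycle lengths for the sum index set: 3 on the left summand and 4 on the
        right, which presents the given disjoint union as an indexed family of cycles.\<close>
      let ?J = "{..<a} <+> {..<b}" and ?k = "case_sum (\<lambda>_. 3) (\<lambda>_. 4) :: nat + nat \<Rightarrow> nat"
      have "case_sum (\<lambda>_. cycle_graph 3) (\<lambda>_. cycle_graph 4) = (\<lambda>i. cycle_graph (?k i))"
        by (auto simp: fun_eq_iff split: sum.split)
      then have "indexed_union ?J (\<lambda>i. cycle_graph (?k i)) \<simeq>\<^sub>g G"
        using graph_iso_trans[OF indexed_union_iso_disjoint_union_copies[OF wf wf] graph_iso_sym[OF ab]]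
        by simp
      then show "real (hom_count G H) = cycle_rate H ^ n"
        by (subst eq_iff) (auto simp: rate)
    qed
  qed
qed

end
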